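(* Let $n\ge 1$ be an integer. For $a<0$ and $\alpha,\beta,\gamma>-1$ let $P_{n,n}^{(\alpha,\beta,\gamma)}(x;a)$ be the diagonal Jacobi-Angelesco polynomial, with zeros $x_{n,1}(a,\alpha,\beta,\gamma)<\cdots<x_{n,2n}(a,\alpha,\beta,\gamma)$. Then: (a) For fixed $a<0$ and $\beta,\gamma>-1$, each zero $x_{n,j}(a,\alpha,\beta,\gamma)$, $j=1,\ldots,2n$, is an increasing function of $\alpha\in(-1,\infty)$. (b) If $a=-1$ and $\alpha=\gamma$ (with this common value $>-1$ fixed), then each negative zero $x_{n,j}(-1,\alpha,\beta,\alpha)$, $j=1,\ldots,n$, is a decreasing function of $\beta\in(-1,\infty)$, and each positive zero $x_{n,j}(-1,\alpha,\beta,\alpha)$, $j=n+1,\ldots,2n$, is an increasing function of $\beta\in(-1,\infty)$. (c) For fixed $a<0$ and $\alpha,\beta>-1$, each zero $x_{n,j}(a,\alpha,\beta,\gamma)$, $j=1,\ldots,2n$, is a decreasing function of $\gamma\in(-1,\infty)$.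
   Context: For $a<0$ and $\alpha,\beta,\gamma>-1$, the (diagonal, type II) Jacobi-Angelesco polynomial $P_{n,n}^{(\alpha,\beta,\gamma)}(x;a)$ is the unique monic polynomial of degree $2n$ satisfying $$\int_a^0 x^k P_{n,n}^{(\alpha,\beta,\gamma)}(x;a)(x-a)^\alpha|x|^\beta(1-x)^\gamma\,dx=0,\qquad \int_0^1 x^k P_{n,n}^{(\alpha,\beta,\gamma)}(x;a)(x-a)^\alpha x^\beta(1-x)^\gamma\,dx=0$$ for $k=0,\ldots,n-1$. It is known that it has $n$ simple zeros in $(a,0)$ and $n$ simple zeros in $(0,1)$; they are labelled increasingly $x_{n,1}<\cdots<x_{n,2n}$, so that $x_{n,1},\ldots,x_{n,n}\in(a,0)$ and $x_{n,n+1},\ldots,x_{n,2n}\in(0,1)$. "Increasing" and "decreasing" are meant in the strict sense. *)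

theory Defs
  imports
    "HOL-Analysis.Analysis"
    "HOL-Computational_Algebra.Polynomial"
begin

text \<open>
  For \<open>a < 0\<close> and \<open>\<alpha>, \<beta>, \<gamma> > -1\<close> the weights are absolutely integrable over the two (open)
  intervals, so none of the Lebesgue integrals below is 0 merely for lack of integrability.
\<close>

definition is_jacobi_angelesco ::
    "nat \<Rightarrow> real \<Rightarrow> real \<Rightarrow> real \<Rightarrow> real \<Rightarrow> real poly \<Rightarrow> bool" where
  "is_jacobi_angelesco n a \<alpha> \<beta> \<gamma> p \<longleftrightarrow>
     lead_coeff p = 1 \<and> degree p = 2 * n \<and>
     (\<forall>k<n. set_lebesgue_integral lborel {a<..<0}
        (\<lambda>x. x ^ k * poly p x * (x - a) powr \<alpha> * \<bar>x\<bar> powr \<beta> * (1 - x) powr \<gamma>) = 0) \<and>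
     (\<forall>k<n. set_lebesgue_integral lborel {0<..<1}
        (\<lambda>x. x ^ k * poly p x * (x - a) powr \<alpha> * x powr \<beta> * (1 - x) powr \<gamma>) = 0)"

definition jacobi_angelesco :: "nat \<Rightarrow> real \<Rightarrow> real \<Rightarrow> real \<Rightarrow> real \<Rightarrow> real poly" where
  "jacobi_angelesco n a \<alpha> \<beta> \<gamma> = (THE p. is_jacobi_angelesco n a \<alpha> \<beta> \<gamma> p)"

text \<open>
  The zeros in increasing order, labelled from \<open>j = 1\<close> to \<open>j = 2 * n\<close> (list positions start
  at 0). All \<open>2 * n\<close> zeros are real and simple, so the set of real roots has exactly \<open>2 * n\<close>
  elements; \<open>n\<close> of them lie in \<open>(a, 0)\<close> and \<open>n\<close> in \<open>(0, 1)\<close>, so the labels \<open>j \<le> n\<close> are those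
  of the negative zeros.
\<close>

definition jacobi_angelesco_zero ::
    "nat \<Rightarrow> nat \<Rightarrow> real \<Rightarrow> real \<Rightarrow> real \<Rightarrow> real \<Rightarrow> real" where
  "jacobi_angelesco_zero n j a \<alpha> \<beta> \<gamma> =
     sorted_list_of_set {x. poly (jacobi_angelesco n a \<alpha> \<beta> \<gamma>) x = 0} ! (j - 1)"

end

theory Submission
  imports Defs
begin

text \<open>
  The zeros of a diagonal Angelesco polynomial \<open>P = P\<^sub>1 P\<^sub>2\<close> (\<open>P\<^sub>1\<close> carrying the zeros left of
  the origin, \<open>P\<^sub>2\<close> those on the right) are a fixed point: \<open>P\<^sub>1\<close> is the ordinary orthogonal
  polynomial on the left interval for the weight \<open>\<bar>P\<^sub>2\<bar> w\<close>, and \<open>P\<^sub>2\<close> the one on the right interval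
  for \<open>P\<^sub>1 w\<close>. Markov's theorem, in the form \<open>markov_zeros_mono\<close>, says that multiplying a weight
  by an increasing function moves all zeros of its orthogonal polynomial to the right. It applies
  to the parameter, and also to the coupling: moving zeros of \<open>P\<^sub>2\<close> to the right multiplies
  \<open>\<bar>P\<^sub>2\<bar>\<close> by factors \<open>(z' - x) / (z - x)\<close>, which increase on the left interval, and likewise for
  \<open>P\<^sub>1\<close>. So the fixed-point map is order preserving. If the new weight is the old one times an
  increasing function, then the old zeros lie below their image under the new map; by the
  Knaster-Tarski argument (\<open>angelesco_fixpoint_above\<close>) the new map has a fixed point above
  the old zeros, and by uniqueness this is the new zero vector. One more application of Markov's
  theorem makes the inequality strict (\<open>angelesco_zeros_strict_mono\<close>). For a larger \<open>\<alpha>\<close> the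
  quotient of the weights is a positive power of \<open>x - a\<close>, for a smaller \<open>\<gamma>\<close> a negative power of
  \<open>1 - x\<close>; both increase on the whole of \<open>(a, 1)\<close>. This gives (a) and (c). The same
  fixed-point argument shows that the polynomials exist.

  Markov's theorem itself is proved without differentiation in the parameter. Let \<open>x\<^sub>i\<close> and
  \<open>y\<^sub>i\<close> be the zeros for the weights \<open>v\<close> and \<open>w = r v\<close>, and suppose \<open>y\<^sub>k \<le> x\<^sub>k\<close>. Let
  \<open>f\<close> vanish at all \<open>x\<^sub>i\<close> with \<open>i < k\<close> and all \<open>y\<^sub>i\<close> with \<open>i > k\<close>. By Gaussian quadrature the
  integral of \<open>(x - x\<^sub>k) f\<^sup>2\<close> is nonnegative for \<open>v\<close> and nonpositive for \<open>w\<close>. But passing from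
  \<open>r(x\<^sub>k) v\<close> to \<open>w\<close> can only increase it, because \<open>(x - x\<^sub>k) (r(x) - r(x\<^sub>k)) \<ge> 0\<close>.

  For (b) the quotient \<open>\<bar>x\<bar>\<^sup>\<delta>\<close> decreases on one side of the origin and increases on the other, and
  the fixed-point map of the symmetric problem reverses the order, so another argument is needed.
  By symmetry \<open>P(x) = p(x\<^sup>2)\<close>. Let \<open>q\<close> belong to the larger parameter, let \<open>\<delta> = 2d\<close> with
  \<open>0 < d < 1\<close>, and consider \<open>H(t) = t\<^sup>d q(t) - c p(t)\<close> for real \<open>c \<noteq> 0\<close>. Orthogonality forces at
  least \<open>n\<close> sign changes of \<open>H\<close> in \<open>(0, 1)\<close>. The coefficients of \<open>p\<close> and \<open>q\<close> alternate in
  sign, so Descartes' rule, which holds for real exponents, allows at most \<open>n\<close> positive zeros if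
  \<open>c < 0\<close> and at most \<open>n + 1\<close> if \<open>c > 0\<close>. Together with a parity argument this excludes double
  zeros for every \<open>c\<close> (\<open>pencil_no_double_zero\<close>). Hence the Wronskian of \<open>p\<close> and \<open>t\<^sup>d q\<close> has no
  positive zero and is positive on \<open>(0, \<infinity>)\<close>, which fixes the signs of \<open>q\<close> at the zeros
  of \<open>p\<close>, and a parity count turns this sign pattern into the inequality between the zeros
  (\<open>symmetric_zeros_less\<close>). Larger steps of \<open>\<beta>\<close> are composed of steps shorter than 2.
\<close>

section \<open>Integrals over an open interval and sign changes\<close>

abbreviation ioo_integral :: "real \<Rightarrow> real \<Rightarrow> (real \<Rightarrow> real) \<Rightarrow> real" where
  "ioo_integral c d g \<equiv> set_lebesgue_integral lborel {c<..<d} g"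

abbreviation ioo_integrable :: "real \<Rightarrow> real \<Rightarrow> (real \<Rightarrow> real) \<Rightarrow> bool" where
  "ioo_integrable c d g \<equiv> set_integrable lborel {c<..<d} g"

text \<open>
  The function \<open>g\<close> is a polynomial, or another continuous function, already multiplied by its weight.
\<close>

definition vanishing_moments :: "real \<Rightarrow> real \<Rightarrow> nat \<Rightarrow> (real \<Rightarrow> real) \<Rightarrow> bool" where
  "vanishing_moments c d n g \<longleftrightarrow> (\<forall>k<n. ioo_integral c d (\<lambda>x. x ^ k * g x) = 0)"

definition weight_on :: "real \<Rightarrow> real \<Rightarrow> (real \<Rightarrow> real) \<Rightarrow> bool" where
  "weight_on c d w \<longleftrightarrow> c < d \<and> ioo_integrable c d w \<and> (\<forall>x\<in>{c<..<d}. 0 < w x)"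

lemma set_integrable_continuous_mult:
  fixes f g :: "real \<Rightarrow> real"
  assumes g: "ioo_integrable c d g" and f: "continuous_on {c..d} f"
  shows "ioo_integrable c d (\<lambda>x. f x * g x)"
proof -
  have "compact (f ` {c..d})"
    using f compact_continuous_image by blast
  then obtain B where B: "\<And>x. x \<in> {c..d} \<Longrightarrow> \<bar>f x\<bar> \<le> B"
    by (meson bounded_real compact_imp_bounded imageI)
  have B': "\<bar>f x\<bar> \<le> \<bar>B\<bar>" if "x \<in> {c<..<d}" for x
    using B[of x] that by force
  have "continuous_on {c<..<d} f"
    using f by (rule continuous_on_subset) auto
  then have m: "(\<lambda>x. indicator {c<..<d} x *\<^sub>R f x) \<in> borel_measurable lborel"
    using borel_measurable_continuous_on_indicator[of "{c<..<d}" f] by simp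
  have m2: "(\<lambda>x. indicator {c<..<d} x *\<^sub>R g x) \<in> borel_measurable lborel"
    using g unfolding set_integrable_def by (rule borel_measurable_integrable)
  have "(\<lambda>x. (indicator {c<..<d} x *\<^sub>R f x) * (indicator {c<..<d} x *\<^sub>R g x)) \<in> borel_measurable lborel"
    using m m2 by (rule borel_measurable_times)
  moreover have "(\<lambda>x. (indicator {c<..<d} x *\<^sub>R f x) * (indicator {c<..<d} x *\<^sub>R g x))
      = (\<lambda>x. indicator {c<..<d} x *\<^sub>R (f x * g x))"
    by (auto simp: indicator_def)
  ultimately have m3: "set_borel_measurable lborel {c<..<d} (\<lambda>x. f x * g x)"
    by (simp add: set_borel_measurable_def)
  have gB: "ioo_integrable c d (\<lambda>x. \<bar>B\<bar> * g x)"
    using g by simp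
  show ?thesis
    by (rule set_integrable_bound[OF gB m3])
       (auto simp: abs_mult intro!: AE_I2 mult_right_mono B')
qed

lemma set_integrable_poly_mult:
  "ioo_integrable c d g \<Longrightarrow> ioo_integrable c d (\<lambda>x. poly p x * g x)"
  by (intro set_integrable_continuous_mult continuous_intros)

text \<open>
  A nonnegative function whose integral vanishes is zero almost everywhere, and an interval is not
  covered by a finite set and a null set.
\<close>

lemma set_integral_pos:
  fixes g :: "real \<Rightarrow> real"
  assumes "c < d" and g: "ioo_integrable c d g"
    and nonneg: "\<And>x. x \<in> {c<..<d} \<Longrightarrow> 0 \<le> g x"
    and fin: "finite {x \<in> {c<..<d}. g x = 0}"
  shows "0 < ioo_integral c d g"
proof -
  let ?h = "\<lambda>x. indicator {c<..<d} x *\<^sub>R g x"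
  have int: "integrable lborel ?h" using g by (simp add: set_integrable_def)
  have nn: "AE x in lborel. 0 \<le> ?h x"
    using nonneg by (auto simp: indicator_def intro!: AE_I2)
  have ge: "0 \<le> ioo_integral c d g"
    unfolding set_lebesgue_integral_def by (rule integral_nonneg_AE[OF nn])
  have "ioo_integral c d g \<noteq> 0"
  proof
    assume "ioo_integral c d g = 0"
    then have "AE x in lborel. ?h x = 0"
      using integral_nonneg_eq_0_iff_AE[OF int nn] by (simp add: set_lebesgue_integral_def)
    moreover have "AE x in lborel. x \<notin> {x \<in> {c<..<d}. g x = 0}"
      using fin by (intro AE_not_in countable_imp_null_set_lborel countable_finite)
    ultimately have "AE x in lborel. x \<notin> {c<..<d}"
      by eventually_elim (auto simp: indicator_def)
    then have "{c<..<d} \<in> null_sets lborel"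
      by (subst (asm) AE_iff_null_sets[symmetric]) auto
    then have "emeasure lborel {c<..<d} = 0" by auto
    with \<open>c < d\<close> show False by simp
  qed
  with ge show ?thesis by linarith
qed

lemma vanishing_moments_poly:
  assumes g: "ioo_integrable c d g" and v: "vanishing_moments c d n g" and q: "degree q < n"
  shows "ioo_integral c d (\<lambda>x. poly q x * g x) = 0"
proof -
  have "ioo_integral c d (\<lambda>x. poly q x * g x)
      = ioo_integral c d (\<lambda>x. \<Sum>k\<le>degree q. coeff q k * (x ^ k * g x))"
    by (simp add: poly_altdef sum_distrib_right mult.assoc)
  also have "\<dots> = (\<Sum>k\<le>degree q. ioo_integral c d (\<lambda>x. coeff q k * (x ^ k * g x)))"
    unfolding set_lebesgue_integral_def scaleR_sum_right
  proof (rule Bochner_Integration.integral_sum)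
    fix k
    have "ioo_integrable c d (\<lambda>x. coeff q k * (x ^ k * g x))"
      using set_integrable_poly_mult[OF g, of "monom 1 k"] by (simp add: poly_monom)
    then show "integrable lborel (\<lambda>x. indicator {c<..<d} x *\<^sub>R (coeff q k * (x ^ k * g x)))"
      by (simp add: set_integrable_def)
  qed
  also have "\<dots> = 0"
    using v q by (intro sum.neutral) (auto simp: vanishing_moments_def)
  finally show ?thesis .
qed

lemma vanishing_moments_cong:
  assumes "\<And>x. x \<in> {c<..<d} \<Longrightarrow> f x = g x"
  shows "vanishing_moments c d n f \<longleftrightarrow> vanishing_moments c d n g"
proof -
  have "ioo_integral c d (\<lambda>x. x ^ k * f x) = ioo_integral c d (\<lambda>x. x ^ k * g x)" for k
    using assms by (intro set_lebesgue_integral_cong) auto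
  then show ?thesis by (simp add: vanishing_moments_def)
qed

text \<open>
  By the intermediate value theorem; the sign is returned as a factor.
\<close>

lemma constant_sign_on_interval:
  fixes f :: "real \<Rightarrow> real"
  assumes "continuous_on {c<..<d} f" and "\<And>x. x \<in> {c<..<d} \<Longrightarrow> f x \<noteq> 0"
  obtains s where "s \<in> {1, -1}" "\<And>x. x \<in> {c<..<d} \<Longrightarrow> 0 < s * f x"
proof -
  have "connected (f ` {c<..<d})"
    by (intro connected_continuous_image assms) auto
  have "(\<forall>x\<in>{c<..<d}. 0 < f x) \<or> (\<forall>x\<in>{c<..<d}. f x < 0)"
  proof (rule ccontr)
    assume "\<not> ?thesis"
    then obtain x y where xy: "x \<in> {c<..<d}" "y \<in> {c<..<d}" "f x \<le> 0" "0 \<le> f y"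
      by (meson linorder_not_le)
    then have "0 \<in> f ` {c<..<d}"
      using connectedD_interval[OF \<open>connected (f ` {c<..<d})\<close>, of "f x" "f y" 0] by blast
    with assms(2) show False by force
  qed
  then show thesis
    using that[of 1] that[of "-1"] by auto
qed

text \<open>
  The set \<open>Y\<close> collects the zeros at which \<open>f\<close> changes sign, so that multiplying by
  \<open>\<Prod>z\<in>Y. x - z\<close> makes the sign constant. The zeros are added from left to right: the product
  for the zeros so far is positive beyond them, so whether the next zero has to be included is
  decided by comparing the sign of \<open>f\<close> after it with the sign factor found so far.
\<close>

lemma sign_change_points:
  fixes f :: "real \<Rightarrow> real"
  assumes "finite Z" "continuous_on {c<..<d} f" "{x \<in> {c<..<d}. f x = 0} = Z"
  shows "\<exists>Y\<subseteq>Z. \<exists>s\<in>{1, -1}. \<forall>x\<in>{c<..<d}. 0 \<le> s * f x * (\<Prod>z\<in>Y. x - z)"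
  using assms
proof (induction Z arbitrary: d rule: finite_linorder_max_induct)
  case empty
  then obtain s where "s \<in> {1, -1}" "\<And>x. x \<in> {c<..<d} \<Longrightarrow> 0 < s * f x"
    using constant_sign_on_interval[of c d f] by blast
  then show ?case
    by (intro exI[of _ "{}"] conjI bexI[of _ s]) (auto intro: less_imp_le)
next
  case (insert b A)
  have bm: "b \<in> {c<..<d}" "f b = 0" using insert.prems(2) by auto
  have zeros_left: "{x \<in> {c<..<b}. f x = 0} = A"
  proof (intro subset_antisym subsetI)
    fix x assume "x \<in> {x \<in> {c<..<b}. f x = 0}"
    then have "x \<in> {x \<in> {c<..<d}. f x = 0}" "x \<noteq> b" using bm by auto
    then show "x \<in> A" using insert.prems(2) by blast
  next
    fix x assume "x \<in> A"
    then have "x \<in> {x \<in> {c<..<d}. f x = 0}" "x < b"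
      using insert.prems(2) insert.hyps(2) by blast+
    then show "x \<in> {x \<in> {c<..<b}. f x = 0}" by simp
  qed
  have "continuous_on {c<..<b} f"
    by (rule continuous_on_subset[OF insert.prems(1)]) (use bm(1) in auto)
  from insert.IH[OF this zeros_left] obtain Y s where Y: "Y \<subseteq> A" "s \<in> {1, -1}"
      "\<forall>x\<in>{c<..<b}. 0 \<le> s * f x * (\<Prod>z\<in>Y. x - z)"
    by (elim exE bexE conjE)
  have Yb: "z < b" if "z \<in> Y" for z
    using that Y(1) insert.hyps(2) by blast
  have finY: "finite Y" using Y(1) insert.hyps(1) by (rule finite_subset)
  have bY: "b \<notin> Y" using Yb by blast
  have "f x \<noteq> 0" if "x \<in> {b<..<d}" for x
  proof
    assume "f x = 0"
    moreover have "x \<in> {c<..<d}" using that bm(1) by simp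
    ultimately have "x \<in> insert b A" using insert.prems(2) by blast
    moreover have "x \<noteq> b" "\<not> x < b" using that by auto
    ultimately show False using insert.hyps(2) by blast
  qed
  moreover have "continuous_on {b<..<d} f"
    by (rule continuous_on_subset[OF insert.prems(1)]) (use bm(1) in auto)
  ultimately obtain t where t: "t \<in> {1, -1}" "\<And>x. x \<in> {b<..<d} \<Longrightarrow> 0 < t * f x"
    using constant_sign_on_interval[of b d f] by blast
  have pos: "0 < (\<Prod>z\<in>Y. x - z)" if "x \<ge> b" for x
    using that Yb by (intro prod_pos) (meson diff_gt_0_iff_gt less_le_trans)
  show ?case
  proof (cases "t = s")
    case True
    have "0 \<le> s * f x * (\<Prod>z\<in>Y. x - z)" if "x \<in> {c<..<d}" for x
    proof (cases x b rule: linorder_cases)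
      case greater
      then show ?thesis using t(2)[of x] pos[of x] that True by simp
    qed (use Y(3) that bm in auto)
    then have "\<forall>x\<in>{c<..<d}. 0 \<le> s * f x * (\<Prod>z\<in>Y. x - z)"
      by (intro ballI)
    moreover have "Y \<subseteq> insert b A" using Y(1) by (rule subset_insertI2)
    ultimately show ?thesis using Y(2) by (intro exI[of _ Y] conjI bexI[of _ s])
  next
    case False
    have ts: "t = - s" using False t(1) Y(2) by auto
    have "0 \<le> (- s) * f x * (\<Prod>z\<in>insert b Y. x - z)" if "x \<in> {c<..<d}" for x
    proof (cases x b rule: linorder_cases)
      case less
      have "(- s) * f x * (\<Prod>z\<in>insert b Y. x - z) = (b - x) * (s * f x * (\<Prod>z\<in>Y. x - z))"
        using finY bY by (simp add: algebra_simps)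
      also have "\<dots> \<ge> 0" using Y(3) less that
        by (intro mult_nonneg_nonneg[OF _ bspec[OF Y(3)]]) auto
      finally show ?thesis .
    next
      case greater
      have "(- s) * f x * (\<Prod>z\<in>insert b Y. x - z) = (x - b) * ((t * f x) * (\<Prod>z\<in>Y. x - z))"
        using finY bY ts by (simp add: algebra_simps)
      also have "\<dots> \<ge> 0"
        using less_imp_le[OF t(2)[of x]] less_imp_le[OF pos[of x]] greater that
        by (intro mult_nonneg_nonneg[OF _ mult_nonneg_nonneg]) auto
      finally show ?thesis .
    qed (use bm in auto)
    then have "\<forall>x\<in>{c<..<d}. 0 \<le> (- s) * f x * (\<Prod>z\<in>insert b Y. x - z)"
      by (intro ballI)
    moreover have "- s \<in> {1, -1}" using Y(2) by auto
    moreover have "insert b Y \<subseteq> insert b A" using Y(1) by (rule insert_mono)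
    ultimately show ?thesis by (intro exI[of _ "insert b Y"] conjI bexI[of _ "- s"])
  qed
qed

text \<open>
  If \<open>f\<close> changed sign fewer than \<open>n\<close> times, the product over the sign changes would be
  a polynomial of degree less than \<open>n\<close>, orthogonal to \<open>f\<close>; but their product has constant sign.
  The sign information is retained for the parity argument in \<open>pencil_no_double_zero\<close>.
\<close>

lemma vanishing_moments_sign_changes:
  fixes f w :: "real \<Rightarrow> real"
  assumes cd: "c < d" and f: "continuous_on {c<..<d} f" and fin: "finite {x \<in> {c<..<d}. f x = 0}"
    and w: "\<forall>x\<in>{c<..<d}. 0 < w x"
    and fw: "ioo_integrable c d (\<lambda>x. f x * w x)"
    and v: "vanishing_moments c d n (\<lambda>x. f x * w x)"
  shows "\<exists>Y\<subseteq>{x \<in> {c<..<d}. f x = 0}. n \<le> card Y \<and>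
    (\<exists>s\<in>{1, -1}. \<forall>x\<in>{c<..<d}. 0 \<le> s * f x * (\<Prod>z\<in>Y. x - z))"
proof -
  from sign_change_points[OF fin f refl]
  obtain Y s where Y: "Y \<subseteq> {x \<in> {c<..<d}. f x = 0}" "s \<in> {1, -1}"
    "\<forall>x\<in>{c<..<d}. 0 \<le> s * f x * (\<Prod>z\<in>Y. x - z)"
    by (elim exE bexE conjE)
  have finY: "finite Y" using Y(1) fin finite_subset by blast
  have "n \<le> card Y"
  proof (rule ccontr)
    assume "\<not> n \<le> card Y"
    define q where "q = smult s (\<Prod>z\<in>Y. [:- z, 1:])"
    have q: "poly q x = s * (\<Prod>z\<in>Y. x - z)" for x
      by (simp add: q_def poly_prod)
    have "degree q \<le> card Y"
      unfolding q_def using degree_prod_sum_le[OF finY, of "\<lambda>z. [:- z, 1:]"]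
      by (auto intro: order.trans[OF degree_smult_le])
    then have "ioo_integral c d (\<lambda>x. poly q x * (f x * w x)) = 0"
      using vanishing_moments_poly[OF fw v] \<open>\<not> n \<le> card Y\<close> by simp
    moreover have "0 < ioo_integral c d (\<lambda>x. poly q x * (f x * w x))"
    proof (rule set_integral_pos[OF cd])
      show "ioo_integrable c d (\<lambda>x. poly q x * (f x * w x))"
        by (rule set_integrable_poly_mult[OF fw])
      show "0 \<le> poly q x * (f x * w x)" if "x \<in> {c<..<d}" for x
      proof -
        have "poly q x * (f x * w x) = (s * f x * (\<Prod>z\<in>Y. x - z)) * w x"
          by (simp add: q)
        also have "\<dots> \<ge> 0"
          by (rule mult_nonneg_nonneg[OF bspec[OF Y(3) that] less_imp_le[OF bspec[OF w that]]])
        finally show ?thesis .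
      qed
      have "{x \<in> {c<..<d}. poly q x * (f x * w x) = 0} \<subseteq> {x \<in> {c<..<d}. f x = 0}"
      proof safe
        fix x assume x: "x \<in> {c<..<d}" "poly q x * (f x * w x) = 0"
        then have "poly q x = 0 \<or> f x = 0" using w by force
        moreover have "f x = 0" if "poly q x = 0"
          using that Y finY by (auto simp: q)
        ultimately show "f x = 0" by blast
      qed
      then show "finite {x \<in> {c<..<d}. poly q x * (f x * w x) = 0}"
        using fin finite_subset by blast
    qed
    ultimately show False by simp
  qed
  then show ?thesis using Y by (intro exI[of _ Y] conjI bexI[of _ s])
qed

lemma vanishing_moments_poly_roots:
  assumes w: "weight_on c d w" and p: "p \<noteq> 0"
    and v: "vanishing_moments c d n (\<lambda>x. poly p x * w x)"
  shows "n \<le> card {x \<in> {c<..<d}. poly p x = 0}"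
proof -
  have fin: "finite {x \<in> {c<..<d}. poly p x = 0}"
    using poly_roots_finite[OF p] by (rule rev_finite_subset) auto
  have fw: "ioo_integrable c d (\<lambda>x. poly p x * w x)"
    using w by (intro set_integrable_poly_mult) (auto simp: weight_on_def)
  have cont: "continuous_on {c<..<d} (poly p)"
    by (intro continuous_intros)
  have w': "c < d" "\<forall>x\<in>{c<..<d}. 0 < w x"
    using w by (auto simp: weight_on_def)
  from vanishing_moments_sign_changes[OF w'(1) cont fin w'(2) fw v]
  obtain Y where "Y \<subseteq> {x \<in> {c<..<d}. poly p x = 0}" "n \<le> card Y"
    by (elim exE conjE)
  with card_mono[OF fin, of Y] show ?thesis by linarith
qed

section \<open>Orthogonal polynomials on one interval and Gaussian quadrature\<close>

text \<open>
  Orthogonal polynomials are handled through their zeros \<open>u 0, \<dots>, u (n - 1)\<close>.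
\<close>

definition node_poly :: "nat \<Rightarrow> (nat \<Rightarrow> real) \<Rightarrow> real poly" where
  "node_poly n u = (\<Prod>i<n. [:- u i, 1:])"

lemma poly_node_poly [simp]: "poly (node_poly n u) x = (\<Prod>i<n. x - u i)"
  by (simp add: node_poly_def poly_prod)

lemma monic_node_poly [simp]: "lead_coeff (node_poly n u) = 1"
  unfolding node_poly_def by (subst lead_coeff_prod) simp

lemma node_poly_nonzero [simp]: "node_poly n u \<noteq> 0"
  using monic_node_poly[of n u] by (metis leading_coeff_0_iff zero_neq_one)

lemma degree_node_poly [simp]: "degree (node_poly n u) = n"
  unfolding node_poly_def by (subst degree_prod_sum_eq) auto

lemma coeff_node_poly_self [simp]: "coeff (node_poly n u) n = 1"
  using monic_node_poly[of n u] by simp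

lemma node_poly_dvd:
  fixes p :: "real poly"
  assumes "inj_on u {..<n}" "\<And>i. i < n \<Longrightarrow> poly p (u i) = 0"
  shows "node_poly n u dvd p"
  using assms
proof (induction n)
  case 0
  then show ?case by (simp add: node_poly_def)
next
  case (Suc n)
  have "inj_on u {..<n}"
    using Suc.prems(1) by (rule inj_on_subset) auto
  then obtain q where q: "p = node_poly n u * q"
    using Suc.IH Suc.prems(2) by (metis dvdE less_SucI)
  have "poly (node_poly n u) (u n) \<noteq> 0"
    using Suc.prems(1) by (force simp: inj_on_def)
  moreover have "poly p (u n) = 0" using Suc.prems(2) by simp
  ultimately have "poly q (u n) = 0" by (simp add: q)
  then have "[:- u n, 1:] dvd q" by (simp add: poly_eq_0_iff_dvd)
  then show ?case
    by (simp add: q node_poly_def mult.commute[of q] mult_dvd_mono del: mult_pCons_left mult_pCons_right)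
qed

definition orth_nodes :: "real \<Rightarrow> real \<Rightarrow> (real \<Rightarrow> real) \<Rightarrow> nat \<Rightarrow> (nat \<Rightarrow> real) \<Rightarrow> bool" where
  "orth_nodes c d w n u \<longleftrightarrow> strict_mono_on {..<n} u \<and> (\<forall>i<n. u i \<in> {c<..<d}) \<and>
     vanishing_moments c d n (\<lambda>x. poly (node_poly n u) x * w x)"

lemma weight_on_integrable: "weight_on c d w \<Longrightarrow> ioo_integrable c d (\<lambda>x. poly p x * w x)"
  by (intro set_integrable_poly_mult) (auto simp: weight_on_def)

lemma weighted_integral_pos:
  assumes w: "weight_on c d w" and p: "p \<noteq> 0" and nn: "\<And>x. x \<in> {c<..<d} \<Longrightarrow> 0 \<le> poly p x"
  shows "0 < ioo_integral c d (\<lambda>x. poly p x * w x)"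
proof (rule set_integral_pos)
  show "ioo_integrable c d (\<lambda>x. poly p x * w x)" by (rule weight_on_integrable[OF w])
  have "{x \<in> {c<..<d}. poly p x * w x = 0} \<subseteq> {x. poly p x = 0}"
    using w by (force simp: weight_on_def)
  then show "finite {x \<in> {c<..<d}. poly p x * w x = 0}"
    using poly_roots_finite[OF p] by (rule finite_subset)
  show "0 \<le> poly p x * w x" if "x \<in> {c<..<d}" for x
    using w nn[OF that] that by (intro mult_nonneg_nonneg) (auto simp: weight_on_def less_imp_le)
qed (use w in \<open>auto simp: weight_on_def\<close>)

lemma integral_poly_add:
  assumes "weight_on c d w"
  shows "ioo_integral c d (\<lambda>x. poly (p + q) x * w x)
    = ioo_integral c d (\<lambda>x. poly p x * w x) + ioo_integral c d (\<lambda>x. poly q x * w x)"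
  using set_integral_add(2)[OF weight_on_integrable[OF assms, of p] weight_on_integrable[OF assms, of q]]
  by (simp add: ring_distribs)

lemma integral_poly_smult:
  "ioo_integral c d (\<lambda>x. poly (smult a p) x * w x) = a * ioo_integral c d (\<lambda>x. poly p x * w x)"
  by (simp add: mult.assoc)

lemma integral_poly_sum:
  assumes "weight_on c d w"
  shows "ioo_integral c d (\<lambda>x. poly (\<Sum>i\<in>I. p i) x * w x)
    = (\<Sum>i\<in>I. ioo_integral c d (\<lambda>x. poly (p i) x * w x))"
proof (induction I rule: infinite_finite_induct)
  case (insert i I)
  then show ?case by (simp only: sum.insert[OF insert.hyps] integral_poly_add[OF assms])
qed auto

text \<open>
  Gram-Schmidt orthogonalisation of the monomials.
\<close>

lemma orthogonal_polynomial_exists: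
  assumes w: "weight_on c d w"
  shows "\<exists>p. lead_coeff p = 1 \<and> degree p = n \<and> vanishing_moments c d n (\<lambda>x. poly p x * w x)"
proof (induction n rule: less_induct)
  case (less n)
  define L where "L = (\<lambda>p. ioo_integral c d (\<lambda>x. poly p x * w x))"
  have L_add: "L (p + q) = L p + L q" for p q
    unfolding L_def by (rule integral_poly_add[OF w])
  have L_smult: "L (smult a p) = a * L p" for a p
    unfolding L_def by (rule integral_poly_smult)
  have L_sum: "L (\<Sum>i\<in>I. p i) = (\<Sum>i\<in>I. L (p i))" for I :: "nat set" and p
    unfolding L_def by (rule integral_poly_sum[OF w])
  from less obtain P where P: "\<And>m. m < n \<Longrightarrow> lead_coeff (P m) = 1"
      "\<And>m. m < n \<Longrightarrow> degree (P m) = m"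
      "\<And>m. m < n \<Longrightarrow> vanishing_moments c d m (\<lambda>x. poly (P m) x * w x)"
    by metis
  have orth: "L (q * P m) = 0" if "m < n" "degree q < m" for q m
    using vanishing_moments_poly[OF weight_on_integrable[OF w] P(3)[OF that(1)] that(2)]
    by (simp add: L_def mult.assoc)
  have pos: "0 < L (P m * P m)" if "m < n" for m
    unfolding L_def using P(1)[OF that] by (intro weighted_integral_pos[OF w]) auto
  define a where "a = (\<lambda>m. L (monom 1 n * P m) / L (P m * P m))"
  define r where "r = (\<Sum>m<n. smult (- a m) (P m))"
  define p where "p = monom 1 n + r"
  have degr: "degree r < n \<or> r = 0"
  proof (cases "n = 0")
    case False
    have "degree r \<le> n - 1"
      unfolding r_def
    proof (rule degree_sum_le)
      fix m assume "m \<in> {..<n}"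
      then show "degree (smult (- a m) (P m)) \<le> n - 1"
        using degree_smult_le[of "- a m" "P m"] P(2)[of m] by simp
    qed simp
    with False show ?thesis by linarith
  qed (simp add: r_def)
  have degp: "degree p = n"
    using degr by (auto simp: p_def degree_monom_eq degree_add_eq_left)
  have lcp: "lead_coeff p = 1"
    using degr unfolding degp by (auto simp: p_def coeff_eq_0)
  have Pp: "L (p * P j) = 0" if j: "j < n" for j
  proof -
    have "L (P m * P j) = 0" if "m < n" "m \<noteq> j" for m
      using orth[of j "P m"] orth[of m "P j"] P(2)[of m] P(2)[of j] j that
      by (cases m j rule: linorder_cases) (auto simp: mult.commute)
    then have "(\<Sum>m<n. - a m * L (P m * P j)) = (\<Sum>m<n. if m = j then - a j * L (P j * P j) else 0)"
      by (intro sum.cong) auto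
    also have "\<dots> = - L (monom 1 n * P j)"
      using j pos[OF j] by (simp add: a_def)
    finally show ?thesis
      by (simp add: p_def r_def ring_distribs L_add L_smult L_sum sum_distrib_right
            flip: smult_minus_left del: smult_minus_left)
  qed
  have all: "degree q < n \<Longrightarrow> L (q * p) = 0" for q
  proof (induction "degree q" arbitrary: q rule: less_induct)
    case less
    define m where "m = degree q"
    have m: "m < n" using less.prems by (simp add: m_def)
    \<comment> \<open>removing the leading term with the help of \<open>P m\<close>\<close>
    define q' where "q' = q - smult (lead_coeff q) (P m)"
    have L0: "L (q * p) = L (q' * p)"
    proof -
      have "q * p = q' * p + smult (lead_coeff q) (p * P m)"
        by (simp add: q'_def algebra_simps)
      then show ?thesis using Pp[OF m] by (simp add: L_add L_smult)
    qed
    show ?case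
    proof (cases "q' = 0")
      case True
      then show ?thesis using L0 by (simp add: L_def)
    next
      case False
      have "coeff q' m = 0" using P(1,2)[OF m] by (simp add: q'_def m_def)
      moreover have "degree q' \<le> m"
        unfolding q'_def using P(2)[OF m]
        by (intro degree_diff_le order.trans[OF degree_smult_le]) (auto simp: m_def)
      ultimately have "degree q' < m"
        using False by (metis le_neq_implies_less leading_coeff_0_iff)
      then show ?thesis using less.hyps[of q'] m L0 by (simp add: m_def)
    qed
  qed
  have "vanishing_moments c d n (\<lambda>x. poly p x * w x)"
    unfolding vanishing_moments_def
  proof (intro allI impI)
    fix k assume "k < n"
    then show "ioo_integral c d (\<lambda>x. x ^ k * (poly p x * w x)) = 0"
      using all[of "monom 1 k"] by (simp add: L_def poly_monom degree_monom_eq mult.assoc)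
  qed
  with degp lcp show ?case by blast
qed

lemma monic_eq_node_poly:
  fixes p :: "real poly"
  assumes "lead_coeff p = 1" "degree p = n" "inj_on u {..<n}" "\<And>i. i < n \<Longrightarrow> poly p (u i) = 0"
  shows "p = node_poly n u"
proof -
  have "node_poly n u dvd p" using assms(3,4) by (rule node_poly_dvd)
  then obtain q where q: "p = node_poly n u * q" by (elim dvdE)
  have "q \<noteq> 0" using assms(1) q by auto
  then have "degree q = 0"
    using assms(2) q degree_mult_eq[of "node_poly n u" q] by simp
  moreover have "lead_coeff q = 1"
    using assms(1) q by (simp add: lead_coeff_mult)
  ultimately have "q = 1" by (metis degree_eq_zeroE lead_coeff_pCons(2) one_pCons pCons_0_0)
  then show ?thesis using q by simp
qed

lemma finite_set_increasing_enumeration: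
  fixes A :: "real set"
  assumes "finite A" "card A = n"
  obtains u where "strict_mono_on {..<n} u" "u ` {..<n} = A"
proof -
  define u where "u = (!) (sorted_list_of_set A)"
  have len: "length (sorted_list_of_set A) = n" using assms by simp
  have "u ` {..<n} = A"
    using set_conv_nth[of "sorted_list_of_set A"] len assms by (auto simp: u_def)
  moreover have "strict_mono_on {..<n} u"
    unfolding u_def strict_mono_on_def
    using sorted_wrt_nth_less[OF strict_sorted_list_of_set[of A]] len by auto
  ultimately show thesis using that by blast
qed

text \<open>
  A monic orthogonal polynomial has at least \<open>n\<close> zeros in the interval because of its sign changes,
  hence exactly \<open>n\<close> simple ones.
\<close>

lemma orth_nodes_exist:
  assumes w: "weight_on c d w"
  shows "\<exists>u. orth_nodes c d w n u"
proof -
  obtain p where p: "lead_coeff p = 1" "degree p = n" "vanishing_moments c d n (\<lambda>x. poly p x * w x)"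
    using orthogonal_polynomial_exists[OF w] by blast
  have p0: "p \<noteq> 0" using p(1) by auto
  define Z where "Z = {x \<in> {c<..<d}. poly p x = 0}"
  have "n \<le> card Z"
    unfolding Z_def by (rule vanishing_moments_poly_roots[OF w p0 p(3)])
  moreover have "finite Z"
    unfolding Z_def using poly_roots_finite[OF p0] by (rule rev_finite_subset) auto
  moreover have "card Z \<le> card {x. poly p x = 0}"
    unfolding Z_def using poly_roots_finite[OF p0] by (rule card_mono) auto
  moreover have "card {x. poly p x = 0} \<le> n"
    using card_poly_roots_bound[OF p0] p(2) by simp
  ultimately have "card Z = n" "finite Z" by auto
  then obtain u where u: "strict_mono_on {..<n} u" "u ` {..<n} = Z"
    using finite_set_increasing_enumeration by metis
  have uZ: "u i \<in> Z" if "i < n" for i using u(2) that by blast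
  have "p = node_poly n u"
    using uZ u(1) by (intro monic_eq_node_poly p strict_mono_on_imp_inj_on) (auto simp: Z_def)
  then show ?thesis
    using u(1) uZ p(3) by (intro exI[of _ u]) (auto simp: orth_nodes_def Z_def)
qed

text \<open>
  The weights are the integrals of the squares \<open>e\<^sub>i\<^sup>2\<close> of the Lagrange basis polynomials, so they are
  positive. The difference of \<open>h\<close> and \<open>\<Sum> h(u\<^sub>i) e\<^sub>i\<^sup>2\<close> vanishes at all nodes, hence is the orthogonal
  polynomial times a factor of degree less than \<open>n\<close>, and integrates to zero.
\<close>

lemma gauss_quadrature:
  assumes w: "weight_on c d w" and u: "orth_nodes c d w n u"
  obtains l where "\<And>i. i < n \<Longrightarrow> 0 < l i"
    "\<And>h. degree h < 2 * n \<Longrightarrow>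
       ioo_integral c d (\<lambda>x. poly h x * w x) = (\<Sum>i<n. l i * poly h (u i))"
proof -
  define L where "L = (\<lambda>p. ioo_integral c d (\<lambda>x. poly p x * w x))"
  \<comment> \<open>the Lagrange basis of the nodes\<close>
  define e where "e = (\<lambda>i. \<Prod>j\<in>{..<n} - {i}. smult (1 / (u i - u j)) [:- u j, 1:])"
  have inj: "inj_on u {..<n}"
    using u unfolding orth_nodes_def by (intro strict_mono_on_imp_inj_on) auto
  have e_self: "poly (e i) (u i) = 1" if "i < n" for i
    unfolding e_def poly_prod
  proof (intro prod.neutral ballI)
    fix j assume "j \<in> {..<n} - {i}"
    then have "u i - u j \<noteq> 0" using inj that by (force simp: inj_on_def)
    then show "poly (smult (1 / (u i - u j)) [:- u j, 1:]) (u i) = 1"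
      by (simp flip: diff_divide_distrib)
  qed
  have e_other: "poly (e i) (u j) = 0" if "i < n" "j < n" "i \<noteq> j" for i j
    unfolding e_def poly_prod using that by (intro prod_zero bexI[of _ j]) auto
  have e_deg: "degree (e i) \<le> n - 1" if "i < n" for i
  proof -
    have "degree (e i) \<le> (\<Sum>j\<in>{..<n} - {i}. 1)"
      unfolding e_def
      by (rule order.trans[OF degree_prod_sum_le sum_mono])
         (auto intro: order.trans[OF degree_smult_le])
    with that show ?thesis by simp
  qed
  have e0: "e i \<noteq> 0" if "i < n" for i
    using e_self[OF that] by auto
  define l where "l = (\<lambda>i. L (e i * e i))"
  have "0 < l i" if "i < n" for i
    unfolding l_def L_def using e0[OF that] by (intro weighted_integral_pos[OF w]) auto
  moreover have "L h = (\<Sum>i<n. l i * poly h (u i))" if h: "degree h < 2 * n" for h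
  proof -
    define s where "s = (\<Sum>i<n. smult (poly h (u i)) (e i * e i))"
    have "poly s (u j) = poly h (u j)" if "j < n" for j
    proof -
      have "poly s (u j) = (\<Sum>i<n. if i = j then poly h (u j) else 0)"
        unfolding s_def poly_sum
        using that e_self e_other by (intro sum.cong) auto
      then show ?thesis using that by simp
    qed
    then have "node_poly n u dvd h - s"
      by (intro node_poly_dvd inj) auto
    then obtain q where q: "h - s = node_poly n u * q" by (elim dvdE)
    have "degree s \<le> 2 * n - 1"
      unfolding s_def
    proof (rule degree_sum_le)
      fix i assume "i \<in> {..<n}"
      then have "degree (e i * e i) \<le> 2 * n - 1"
        using degree_mult_le[of "e i" "e i"] e_deg[of i] by auto
      then show "degree (smult (poly h (u i)) (e i * e i)) \<le> 2 * n - 1"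
        by (rule order.trans[OF degree_smult_le])
    qed simp
    then have dhs: "degree (h - s) \<le> 2 * n - 1"
      using h by (intro degree_diff_le) auto
    have "L (h - s) = 0"
    proof (cases "q = 0")
      case False
      then have "degree q < n"
        using dhs h unfolding q by (simp add: degree_mult_eq)
      then have "ioo_integral c d (\<lambda>x. poly q x * (poly (node_poly n u) x * w x)) = 0"
        using u unfolding orth_nodes_def
        by (intro vanishing_moments_poly[OF weight_on_integrable[OF w]]) auto
      then show ?thesis
        unfolding q L_def poly_mult by (simp only: mult_ac)
    qed (simp add: q L_def)
    moreover have "L h = L (h - s) + L s"
      using integral_poly_add[OF w, of "h - s" s] by (simp add: L_def)
    moreover have "L s = (\<Sum>i<n. poly h (u i) * l i)"
      unfolding s_def l_def L_def integral_poly_sum[OF w] integral_poly_smult ..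
    ultimately show ?thesis by (simp add: mult.commute)
  qed
  ultimately show thesis using that unfolding L_def by blast
qed

section \<open>Monotonicity of the zeros in the weight\<close>

text \<open>
  If \<open>y k \<le> x k\<close>, then \<open>f\<close>, vanishing at the \<open>k\<close> leftmost \<open>x i\<close> and the \<open>n - 1 - k\<close> rightmost
  \<open>y i\<close>, separates the two weights: in the quadrature sum for \<open>v\<close> only nodes at or to the right of
  \<open>x k\<close> survive, in the sum for \<open>w\<close> only nodes at or to the left of it. The degree of
  \<open>(t - x k) f\<^sup>2\<close> is \<open>2 n - 1\<close>, the largest for which the quadrature is exact.
\<close>

lemma quadrature_separator:
  assumes v: "weight_on c d v" and w: "weight_on c d w"
    and x: "orth_nodes c d v n x" and y: "orth_nodes c d w n y"
    and k: "k < n" and le: "y k \<le> x k"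
  obtains f where "f \<noteq> 0"
    "0 \<le> ioo_integral c d (\<lambda>t. poly ([:- x k, 1:] * f ^ 2) t * v t)"
    "ioo_integral c d (\<lambda>t. poly ([:- x k, 1:] * f ^ 2) t * w t) \<le> 0"
    "y k < x k \<Longrightarrow> ioo_integral c d (\<lambda>t. poly ([:- x k, 1:] * f ^ 2) t * w t) < 0"
proof -
  define f where "f = (\<Prod>i<k. [:- x i, 1:]) * (\<Prod>i\<in>{k<..<n}. [:- y i, 1:])"
  define h where "h = [:- x k, 1:] * f ^ 2"
  have f0: "f \<noteq> 0" by (auto simp: f_def)
  have poly_h: "poly h t = (t - x k) * (poly f t)\<^sup>2" for t
    by (simp add: h_def algebra_simps)
  have fx: "poly f (x i) = 0" if "i < k" for i
    using that by (auto simp: f_def poly_prod)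
  have fy: "poly f (y i) = 0" if "k < i" "i < n" for i
    using that by (auto simp: f_def poly_prod)
  have deg_f: "degree f = n - 1"
    using k unfolding f_def
    by (subst degree_mult_eq) (auto simp: degree_prod_eq_sum_degree)
  have deg_h: "degree h < 2 * n"
    unfolding h_def using f0 k by (simp add: degree_mult_eq degree_power_eq deg_f del: mult_pCons_left)
  have sx: "strict_mono_on {..<n} x" and sy: "strict_mono_on {..<n} y"
    using x y by (auto simp: orth_nodes_def)
  obtain l where l: "\<And>i. i < n \<Longrightarrow> 0 < l i"
    "\<And>h. degree h < 2 * n \<Longrightarrow> ioo_integral c d (\<lambda>t. poly h t * v t) = (\<Sum>i<n. l i * poly h (x i))"
    using gauss_quadrature[OF v x] by metis
  obtain m where m: "\<And>i. i < n \<Longrightarrow> 0 < m i"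
    "\<And>h. degree h < 2 * n \<Longrightarrow> ioo_integral c d (\<lambda>t. poly h t * w t) = (\<Sum>i<n. m i * poly h (y i))"
    using gauss_quadrature[OF w y] by metis
  have "0 \<le> poly h (x i)" if "i < n" for i
  proof (cases "i < k")
    case False
    then have "x k \<le> x i"
      using sx that k by (metis lessThan_iff linorder_not_less order.refl order_le_less strict_mono_onD)
    then show ?thesis by (simp add: poly_h)
  qed (simp add: poly_h fx)
  then have int_v: "0 \<le> ioo_integral c d (\<lambda>t. poly h t * v t)"
    unfolding l(2)[OF deg_h] using l(1) by (intro sum_nonneg mult_nonneg_nonneg) (auto simp: less_imp_le)
  have y_le: "y i \<le> y k" if "i \<le> k" for i
    using sy that k by (metis le_neq_implies_less lessThan_iff less_imp_le order.refl order.strict_trans1 strict_mono_onD)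
  have hy: "m i * poly h (y i) \<le> 0" if "i < n" for i
  proof (cases "k < i")
    case False
    then have "y i - x k \<le> 0" using y_le[of i] le by simp
    then have "poly h (y i) \<le> 0" unfolding poly_h by (rule mult_nonpos_nonneg) simp
    with m(1)[OF that] show ?thesis by (simp add: mult_nonneg_nonpos)
  qed (simp add: poly_h fy that)
  then have int_w: "ioo_integral c d (\<lambda>t. poly h t * w t) \<le> 0"
    unfolding m(2)[OF deg_h] by (intro sum_nonpos) auto
  have int_w': "ioo_integral c d (\<lambda>t. poly h t * w t) < 0" if lt: "y k < x k"
  proof -
    have "\<exists>i<n. poly f (y i) \<noteq> 0"
    proof (rule ccontr)
      assume "\<not> ?thesis"
      then have "node_poly n y dvd f"
        using strict_mono_on_imp_inj_on[OF sy] by (intro node_poly_dvd) auto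
      then have "n \<le> degree f" using f0 dvd_imp_degree_le[of "node_poly n y" f] by simp
      with deg_f k show False by simp
    qed
    then obtain i where i: "i < n" "poly f (y i) \<noteq> 0" by blast
    then have "i \<le> k" using fy by (meson linorder_not_le)
    then have "y i - x k < 0" using y_le[of i] lt by simp
    then have "poly h (y i) < 0" unfolding poly_h using i(2) by (intro mult_neg_pos) auto
    then have "m i * poly h (y i) < 0" using m(1)[OF i(1)] by (simp add: mult_pos_neg)
    moreover have "(\<Sum>i<n. m i * poly h (y i)) \<le> (\<Sum>j\<in>{i}. m j * poly h (y j))"
      using sum_mono2[of "{..<n}" "{i}" "\<lambda>i. - (m i * poly h (y i))"] hy i(1)
      by (auto simp: sum_negf)
    ultimately show ?thesis unfolding m(2)[OF deg_h] by simp
  qed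
  show thesis
    by (rule that[OF f0 int_v[unfolded h_def] int_w[unfolded h_def] int_w'[unfolded h_def]])
qed

text \<open>
  The integral for \<open>w = r v\<close> exceeds \<open>r s\<close> times the integral for \<open>v\<close>, since the difference has the
  integrand \<open>(t - s) (r t - r s) f\<^sup>2 v \<ge> 0\<close>.
\<close>

lemma markov_increment:
  fixes r :: "real \<Rightarrow> real"
  assumes v: "weight_on c d v" and w: "weight_on c d w"
    and r: "\<forall>t\<in>{c<..<d}. w t = r t * v t" and mono: "mono_on {c<..<d} r"
    and s: "s \<in> {c<..<d}" and f: "f \<noteq> 0"
    and nn: "0 \<le> ioo_integral c d (\<lambda>t. poly ([:- s, 1:] * f ^ 2) t * v t)"
  shows "0 \<le> ioo_integral c d (\<lambda>t. poly ([:- s, 1:] * f ^ 2) t * w t)"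
    and "strict_mono_on {c<..<d} r \<Longrightarrow> 0 < ioo_integral c d (\<lambda>t. poly ([:- s, 1:] * f ^ 2) t * w t)"
proof -
  define h where "h = [:- s, 1:] * f ^ 2"
  have poly_h: "poly h t = (t - s) * (poly f t)\<^sup>2" for t
    by (simp add: h_def algebra_simps)
  define g where "g = (\<lambda>t. poly h t * w t - r s * (poly h t * v t))"
  have g_eq: "g t = ((t - s) * (r t - r s)) * ((poly f t)\<^sup>2 * v t)" if "t \<in> {c<..<d}" for t
    unfolding g_def poly_h bspec[OF r that] by (simp add: algebra_simps)
  have hw: "ioo_integrable c d (\<lambda>t. poly h t * w t)" and hv: "ioo_integrable c d (\<lambda>t. poly h t * v t)"
    using weight_on_integrable[OF w] weight_on_integrable[OF v] by auto
  have hv': "ioo_integrable c d (\<lambda>t. r s * (poly h t * v t))" using hv by simp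
  have gi: "ioo_integrable c d g"
    unfolding g_def using set_integral_diff(1)[OF hw hv'] .
  have int_g: "ioo_integral c d g
      = ioo_integral c d (\<lambda>t. poly h t * w t) - r s * ioo_integral c d (\<lambda>t. poly h t * v t)"
    unfolding g_def set_integral_diff(2)[OF hw hv'] by simp
  have vpos: "0 < v t" if "t \<in> {c<..<d}" for t using v that by (auto simp: weight_on_def)
  have "0 < w s" using w s by (auto simp: weight_on_def)
  then have "0 < r s * v s" using bspec[OF r s] by simp
  then have rs: "0 \<le> r s" using vpos[OF s] by (simp add: zero_less_mult_iff)
  have prod_nn: "0 \<le> (t - s) * (r t - r s)" if "t \<in> {c<..<d}" for t
    using mono_onD[OF mono that s] mono_onD[OF mono s that]
    by (cases "t \<le> s") (auto intro: mult_nonneg_nonneg mult_nonpos_nonpos)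
  have g_nn: "0 \<le> g t" if "t \<in> {c<..<d}" for t
    unfolding g_eq[OF that] using vpos[OF that]
    by (intro mult_nonneg_nonneg[OF prod_nn[OF that]]) auto
  have "0 \<le> ioo_integral c d g"
    unfolding set_lebesgue_integral_def
    using g_nn by (intro integral_nonneg_AE AE_I2) (auto simp: indicator_def)
  with int_g nn rs show "0 \<le> ioo_integral c d (\<lambda>t. poly ([:- s, 1:] * f ^ 2) t * w t)"
    unfolding h_def by (smt (verit) mult_nonneg_nonneg)
  assume strict: "strict_mono_on {c<..<d} r"
  have "0 < ioo_integral c d g"
  proof (rule set_integral_pos)
    show "c < d" using v by (simp add: weight_on_def)
    have "{t \<in> {c<..<d}. g t = 0} \<subseteq> insert s {t. poly f t = 0}"
    proof
      fix t assume t: "t \<in> {t \<in> {c<..<d}. g t = 0}"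
      then have tI: "t \<in> {c<..<d}" and "g t = 0" by auto
      then have "(t - s) * (r t - r s) = 0 \<or> poly f t = 0"
        using g_eq[OF tI] vpos[OF tI] by auto
      moreover have "t = s" if "r t = r s"
        using strict_mono_on_eqD[OF strict _ tI s] that by simp
      ultimately show "t \<in> insert s {t. poly f t = 0}" by auto
    qed
    then show "finite {t \<in> {c<..<d}. g t = 0}"
      by (rule finite_subset) (use poly_roots_finite[OF f] in auto)
  qed (use gi g_nn in auto)
  with int_g nn rs show "0 < ioo_integral c d (\<lambda>t. poly ([:- s, 1:] * f ^ 2) t * w t)"
    unfolding h_def by (smt (verit) mult_nonneg_nonneg)
qed

text \<open>
  Markov's theorem: the two preceding lemmas, with \<open>s = x k\<close>, contradict each other
  if the zero \<open>y k\<close> lies on the wrong side of \<open>x k\<close>.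
\<close>

theorem markov_zeros_mono:
  fixes r :: "real \<Rightarrow> real"
  assumes v: "weight_on c d v" and w: "weight_on c d w"
    and x: "orth_nodes c d v n x" and y: "orth_nodes c d w n y"
    and r: "\<forall>t\<in>{c<..<d}. w t = r t * v t" and mono: "mono_on {c<..<d} r"
    and k: "k < n"
  shows "x k \<le> y k" and "strict_mono_on {c<..<d} r \<Longrightarrow> x k < y k"
proof -
  have xk: "x k \<in> {c<..<d}" using x k by (simp add: orth_nodes_def)
  note inc = markov_increment[OF v w r mono xk]
  show "x k \<le> y k"
  proof (rule ccontr)
    assume "\<not> x k \<le> y k"
    then have lt: "y k < x k" by simp
    show False
    proof (rule quadrature_separator[OF v w x y k less_imp_le[OF lt]])
      fix f assume f: "f \<noteq> 0"
        "0 \<le> ioo_integral c d (\<lambda>t. poly ([:- x k, 1:] * f ^ 2) t * v t)"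
        "y k < x k \<Longrightarrow> ioo_integral c d (\<lambda>t. poly ([:- x k, 1:] * f ^ 2) t * w t) < 0"
      show False using inc(1)[OF f(1,2)] f(3)[OF lt] by (rule leD[THEN notE])
    qed
  qed
  assume strict: "strict_mono_on {c<..<d} r"
  show "x k < y k"
  proof (rule ccontr)
    assume "\<not> x k < y k"
    then have le: "y k \<le> x k" by simp
    show False
    proof (rule quadrature_separator[OF v w x y k le])
      fix f assume f: "f \<noteq> 0"
        "0 \<le> ioo_integral c d (\<lambda>t. poly ([:- x k, 1:] * f ^ 2) t * v t)"
        "ioo_integral c d (\<lambda>t. poly ([:- x k, 1:] * f ^ 2) t * w t) \<le> 0"
      show False using f(3) inc(2)[OF f(1,2) strict] by (rule leD[THEN notE])
    qed
  qed
qed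

section \<open>Two touching intervals\<close>

text \<open>
  The weight for the left factor \<open>P\<^sub>1\<close>: the right factor is absorbed as \<open>\<bar>P\<^sub>2\<bar>\<close>, which on the left
  interval is the product of the \<open>z (n + i) - x\<close>. The entries \<open>z 0, \<dots>, z (n - 1)\<close> are the left
  zeros and \<open>z n, \<dots>, z (2 n - 1)\<close> the right ones.
\<close>

definition left_weight :: "nat \<Rightarrow> (nat \<Rightarrow> real) \<Rightarrow> (real \<Rightarrow> real) \<Rightarrow> real \<Rightarrow> real" where
  "left_weight n z w = (\<lambda>x. (\<Prod>i<n. z (n + i) - x) * w x)"

definition right_weight :: "nat \<Rightarrow> (nat \<Rightarrow> real) \<Rightarrow> (real \<Rightarrow> real) \<Rightarrow> real \<Rightarrow> real" where
  "right_weight n z w = (\<lambda>x. (\<Prod>i<n. x - z i) * w x)"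

text \<open>
  The relation \<open>u = T z\<close> for the map \<open>T\<close> that computes each group of zeros from the other group.
  The zeros of the Angelesco polynomial are the \<open>z\<close> with \<open>z = T z\<close>.
\<close>

definition angelesco_image ::
    "real \<Rightarrow> real \<Rightarrow> real \<Rightarrow> (real \<Rightarrow> real) \<Rightarrow> nat \<Rightarrow> (nat \<Rightarrow> real) \<Rightarrow> (nat \<Rightarrow> real) \<Rightarrow> bool" where
  "angelesco_image a b c w n z u \<longleftrightarrow>
     orth_nodes a b (left_weight n z w) n u \<and>
     orth_nodes b c (right_weight n z w) n (\<lambda>i. u (n + i))"

text \<open>
  The boxes are closed, and the entries may coincide or be unordered, so that this set of vectors is a complete
  lattice under the componentwise order.
\<close>

definition in_box :: "real \<Rightarrow> real \<Rightarrow> real \<Rightarrow> nat \<Rightarrow> (nat \<Rightarrow> real) \<Rightarrow> bool" where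
  "in_box a b c n z \<longleftrightarrow> (\<forall>i<n. z i \<in> {a..b} \<and> z (n + i) \<in> {b..c})"

lemma all_less_double: "(\<forall>i<2 * n. P i) \<longleftrightarrow> (\<forall>i<n. P i \<and> P (n + i))" for n :: nat
proof
  assume P: "\<forall>i<n. P i \<and> P (n + i)"
  show "\<forall>i<2 * n. P i"
  proof (intro allI impI)
    fix i assume "i < 2 * n"
    then show "P i" using P[rule_format, of i] P[rule_format, of "i - n"] by (cases "i < n") auto
  qed
qed auto

lemma prod_lessThan_add: "(\<Prod>i<n + m. f i) = (\<Prod>i<n. f i) * (\<Prod>i<m. f (n + i))"
  for f :: "nat \<Rightarrow> 'a::comm_monoid_mult"
  by (induction m) (simp_all add: mult.assoc)

lemma weight_on_mult:
  assumes w: "weight_on c d w" and f: "continuous_on {c..d} f" and pos: "\<And>x. x \<in> {c<..<d} \<Longrightarrow> 0 < f x"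
  shows "weight_on c d (\<lambda>x. f x * w x)"
  using w set_integrable_continuous_mult[OF _ f, of w] pos
  by (auto simp: weight_on_def intro!: mult_pos_pos)

lemma weight_on_left:
  assumes "weight_on a b w" "\<And>i. i < n \<Longrightarrow> b \<le> z (n + i)"
  shows "weight_on a b (left_weight n z w)"
  unfolding left_weight_def
  using assms(2) by (intro weight_on_mult assms(1) continuous_intros prod_pos) fastforce

lemma weight_on_right:
  assumes "weight_on b c w" "\<And>i. i < n \<Longrightarrow> z i \<le> b"
  shows "weight_on b c (right_weight n z w)"
  unfolding right_weight_def
  using assms(2) by (intro weight_on_mult assms(1) continuous_intros prod_pos) fastforce

lemma orth_nodes_cong:
  assumes "\<And>i. i < n \<Longrightarrow> u i = u' i"
  shows "orth_nodes c d w n u \<longleftrightarrow> orth_nodes c d w n u'"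
proof -
  have "node_poly n u = node_poly n u'"
    unfolding node_poly_def using assms by (intro prod.cong) auto
  then show ?thesis
    using assms by (simp add: orth_nodes_def strict_mono_on_def)
qed

lemma angelesco_image_cong:
  assumes "\<forall>i<2 * n. u i = u' i" and "\<forall>i<2 * n. z i = z' i"
  shows "angelesco_image a b c w n z u \<longleftrightarrow> angelesco_image a b c w n z' u'"
proof -
  have "left_weight n z w = left_weight n z' w" "right_weight n z w = right_weight n z' w"
    using assms(2) by (auto simp: left_weight_def right_weight_def fun_eq_iff)
  then show ?thesis
    using assms(1) orth_nodes_cong[of n u u'] orth_nodes_cong[of n "\<lambda>i. u (n + i)" "\<lambda>i. u' (n + i)"]
    by (simp add: angelesco_image_def)
qed

lemma angelesco_image_exists:
  assumes "weight_on a b w" "weight_on b c w" "in_box a b c n z"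
  shows "\<exists>u. angelesco_image a b c w n z u"
proof -
  obtain u1 where u1: "orth_nodes a b (left_weight n z w) n u1"
    using orth_nodes_exist[OF weight_on_left[OF assms(1), of n z]] assms(3) by (force simp: in_box_def)
  obtain u2 where u2: "orth_nodes b c (right_weight n z w) n u2"
    using orth_nodes_exist[OF weight_on_right[OF assms(2), of n z]] assms(3) by (force simp: in_box_def)
  define u where "u = (\<lambda>i. if i < n then u1 i else u2 (i - n))"
  have "angelesco_image a b c w n z u"
    unfolding angelesco_image_def
    using u1 u2 orth_nodes_cong[of n u u1] orth_nodes_cong[of n "\<lambda>i. u (n + i)" u2]
    by (simp add: u_def)
  then show ?thesis by (intro exI[of _ u])
qed

lemma angelesco_image_in_box: "angelesco_image a b c w n z u \<Longrightarrow> in_box a b c n u"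
  by (auto simp: angelesco_image_def orth_nodes_def in_box_def less_imp_le)

text \<open>
  Quotients of weights for different parameters and different outer zeros have this product form.
\<close>

lemma mono_on_prod_mult:
  fixes f :: "nat \<Rightarrow> real \<Rightarrow> real"
  assumes f: "\<forall>i<n. mono_on I (f i)" and fpos: "\<forall>i<n. \<forall>t\<in>I. 0 < f i t"
    and rpos: "\<forall>t\<in>I. 0 < r t" and r: "mono_on I r"
  shows "mono_on I (\<lambda>t. (\<Prod>i<n. f i t) * r t)"
    and "strict_mono_on I r \<Longrightarrow> strict_mono_on I (\<lambda>t. (\<Prod>i<n. f i t) * r t)"
proof -
  have le: "(\<Prod>i<n. f i s) \<le> (\<Prod>i<n. f i t)" if "s \<in> I" "t \<in> I" "s \<le> t" for s t
    using that f fpos by (intro prod_mono) (auto simp: less_imp_le dest: mono_onD)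
  have pos: "0 < (\<Prod>i<n. f i t)" if "t \<in> I" for t
    using that fpos by (intro prod_pos) auto
  show "mono_on I (\<lambda>t. (\<Prod>i<n. f i t) * r t)"
  proof (rule mono_onI)
    fix s t assume st: "s \<in> I" "t \<in> I" "s \<le> t"
    show "(\<Prod>i<n. f i s) * r s \<le> (\<Prod>i<n. f i t) * r t"
      using le[OF st] mono_onD[OF r st] pos[OF st(2)] rpos st(1) by (intro mult_mono) (auto simp: less_imp_le)
  qed
  assume r': "strict_mono_on I r"
  show "strict_mono_on I (\<lambda>t. (\<Prod>i<n. f i t) * r t)"
  proof (rule strict_mono_onI)
    fix s t assume st: "s \<in> I" "t \<in> I" "s < t"
    show "(\<Prod>i<n. f i s) * r s < (\<Prod>i<n. f i t) * r t"
      using le[OF st(1,2)] strict_mono_onD[OF r' st] pos[OF st(1)] rpos st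
      by (intro mult_le_less_imp_less) auto
  qed
qed

text \<open>
  The quotient is \<open>1 + (z' - z) / (z - t)\<close>.
\<close>

lemma left_ratio_mono:
  fixes t :: real
  assumes "s \<le> t" "t < b" "b \<le> z" "z \<le> z'"
  shows "(z' - s) / (z - s) \<le> (z' - t) / (z - t)"
proof -
  have "(z' - z) / (z - s) \<le> (z' - z) / (z - t)"
    using assms by (intro divide_left_mono mult_pos_pos) auto
  moreover have "(z' - s) / (z - s) = 1 + (z' - z) / (z - s)" "(z' - t) / (z - t) = 1 + (z' - z) / (z - t)"
    using assms by (simp_all add: field_simps)
  ultimately show ?thesis by simp
qed

text \<open>
  The quotient is \<open>1 - (z' - z) / (t - z)\<close>.
\<close>

lemma right_ratio_mono:
  fixes t :: real
  assumes "s \<le> t" "b < s" "z' \<le> b" "z \<le> z'"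
  shows "(s - z') / (s - z) \<le> (t - z') / (t - z)"
proof -
  have "(z' - z) / (t - z) \<le> (z' - z) / (s - z)"
    using assms by (intro divide_left_mono mult_pos_pos) auto
  moreover have "(s - z') / (s - z) = 1 - (z' - z) / (s - z)" "(t - z') / (t - z) = 1 - (z' - z) / (t - z)"
    using assms by (simp_all add: field_simps)
  ultimately show ?thesis by simp
qed

text \<open>
  Markov's theorem on each of the two intervals. Both moving the outer zeros to the right and
  multiplying the weight by \<open>r\<close> multiply the effective weight by an increasing function.
\<close>

lemma angelesco_image_mono:
  fixes r :: "real \<Rightarrow> real"
  assumes v: "weight_on a b v" "weight_on b c v" and w: "weight_on a b w" "weight_on b c w"
    and rl: "\<forall>t\<in>{a<..<b}. w t = r t * v t" "mono_on {a<..<b} r"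
    and rr: "\<forall>t\<in>{b<..<c}. w t = r t * v t" "mono_on {b<..<c} r"
    and z: "in_box a b c n z" and z': "in_box a b c n z'" and le: "\<forall>i<2 * n. z i \<le> z' i"
    and x: "angelesco_image a b c v n z x" and y: "angelesco_image a b c w n z' y"
  shows "\<forall>i<2 * n. x i \<le> y i"
    and "strict_mono_on {a<..<b} r \<Longrightarrow> strict_mono_on {b<..<c} r \<Longrightarrow> \<forall>i<2 * n. x i < y i"
proof -
  have rpos: "0 < r t" if "0 < v t" "w t = r t * v t" "0 < w t" for t
    using that by (simp add: zero_less_mult_iff)
  have rposl: "0 < r t" if "t \<in> {a<..<b}" for t
    using v(1) w(1) rl(1) that by (intro rpos) (auto simp: weight_on_def)
  have rposr: "0 < r t" if "t \<in> {b<..<c}" for t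
    using v(2) w(2) rr(1) that by (intro rpos) (auto simp: weight_on_def)
  have zl: "b \<le> z (n + i)" "b \<le> z' (n + i)" "z (n + i) \<le> z' (n + i)" if "i < n" for i
    using z z' le that by (auto simp: in_box_def)
  have zr: "z i \<le> b" "z' i \<le> b" "z i \<le> z' i" if "i < n" for i
    using z z' le that by (auto simp: in_box_def)
  \<comment> \<open>the quotients of the effective weights on the left and on the right\<close>
  define pl where "pl = (\<lambda>t. (\<Prod>i<n. (z' (n + i) - t) / (z (n + i) - t)) * r t)"
  define pr where "pr = (\<lambda>t. (\<Prod>i<n. (t - z' i) / (t - z i)) * r t)"
  have l_eq: "\<forall>t\<in>{a<..<b}. left_weight n z' w t = pl t * left_weight n z v t"
  proof
    fix t assume t: "t \<in> {a<..<b}"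
    have "(\<Prod>i<n. z (n + i) - t) \<noteq> 0" using zl(1) t by fastforce
    then show "left_weight n z' w t = pl t * left_weight n z v t"
      using rl(1) t by (simp add: left_weight_def pl_def prod_dividef)
  qed
  have r_eq: "\<forall>t\<in>{b<..<c}. right_weight n z' w t = pr t * right_weight n z v t"
  proof
    fix t assume t: "t \<in> {b<..<c}"
    have "(\<Prod>i<n. t - z i) \<noteq> 0" using zr(1) t by fastforce
    then show "right_weight n z' w t = pr t * right_weight n z v t"
      using rr(1) t by (simp add: right_weight_def pr_def prod_dividef)
  qed
  define fl where "fl = (\<lambda>i t. (z' (n + i) - t) / (z (n + i) - t))"
  define fr where "fr = (\<lambda>i t. (t - z' i) / (t - z i))"
  have l1: "\<forall>i<n. mono_on {a<..<b} (fl i)"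
    unfolding fl_def using zl by (intro allI impI mono_onI left_ratio_mono[of _ _ b]) auto
  have l2: "\<forall>i<n. \<forall>t\<in>{a<..<b}. 0 < fl i t"
    unfolding fl_def using zl by (intro allI impI ballI divide_pos_pos) (auto intro: less_le_trans)
  have r1: "\<forall>i<n. mono_on {b<..<c} (fr i)"
    unfolding fr_def using zr by (intro allI impI mono_onI right_ratio_mono[of _ _ b]) auto
  have r2: "\<forall>i<n. \<forall>t\<in>{b<..<c}. 0 < fr i t"
    unfolding fr_def using zr by (intro allI impI ballI divide_pos_pos) (auto intro: le_less_trans)
  have pl: "pl = (\<lambda>t. (\<Prod>i<n. fl i t) * r t)" and pr: "pr = (\<lambda>t. (\<Prod>i<n. fr i t) * r t)"
    by (simp_all add: pl_def pr_def fl_def fr_def)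
  note ml = mono_on_prod_mult[OF l1 l2 _ rl(2), folded pl]
  note mr = mono_on_prod_mult[OF r1 r2 _ rr(2), folded pr]
  have wl: "weight_on a b (left_weight n z v)" "weight_on a b (left_weight n z' w)"
    using zl by (auto intro!: weight_on_left v w)
  have wr: "weight_on b c (right_weight n z v)" "weight_on b c (right_weight n z' w)"
    using zr by (auto intro!: weight_on_right v w)
  have xl: "orth_nodes a b (left_weight n z v) n x" and xr: "orth_nodes b c (right_weight n z v) n (\<lambda>i. x (n + i))"
    using x by (auto simp: angelesco_image_def)
  have yl: "orth_nodes a b (left_weight n z' w) n y" and yr: "orth_nodes b c (right_weight n z' w) n (\<lambda>i. y (n + i))"
    using y by (auto simp: angelesco_image_def)
  have ml1: "mono_on {a<..<b} pl" and mr1: "mono_on {b<..<c} pr"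
    using ml(1) mr(1) rposl rposr by auto
  show "\<forall>i<2 * n. x i \<le> y i"
    unfolding all_less_double
    using markov_zeros_mono(1)[OF wl xl yl l_eq ml1] markov_zeros_mono(1)[OF wr xr yr r_eq mr1] by blast
  assume "strict_mono_on {a<..<b} r" "strict_mono_on {b<..<c} r"
  then have "strict_mono_on {a<..<b} pl" "strict_mono_on {b<..<c} pr"
    using ml(2) mr(2) rposl rposr by auto
  then show "\<forall>i<2 * n. x i < y i"
    unfolding all_less_double
    using markov_zeros_mono(2)[OF wl xl yl l_eq ml1] markov_zeros_mono(2)[OF wr xr yr r_eq mr1] by blast
qed

text \<open>
  The Knaster-Tarski argument: the componentwise supremum of all \<open>z\<close> with \<open>z \<le> T z\<close> is a fixed
  point of the order preserving map \<open>T\<close>.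
\<close>

lemma angelesco_fixpoint_above:
  assumes w: "weight_on a b w" "weight_on b c w" and z0: "in_box a b c n z0"
    and up: "\<And>u. angelesco_image a b c w n z0 u \<Longrightarrow> \<forall>i<2 * n. z0 i \<le> u i"
  shows "\<exists>z. angelesco_image a b c w n z z \<and> (\<forall>i<2 * n. z0 i \<le> z i)"
proof -
  define T where "T = (\<lambda>z. SOME u. angelesco_image a b c w n z u)"
  have T: "angelesco_image a b c w n z (T z)" if "in_box a b c n z" for z
    unfolding T_def using angelesco_image_exists[OF w that] by (rule someI_ex)
  have T_box: "in_box a b c n (T z)" if "in_box a b c n z" for z
    by (rule angelesco_image_in_box[OF T[OF that]])
  have one: "\<forall>t\<in>I. w t = (\<lambda>_. 1) t * w t" "mono_on I (\<lambda>_::real. 1::real)" for I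
    by (auto intro: mono_onI)
  have T_mono: "\<forall>i<2 * n. T z i \<le> T z' i"
    if "in_box a b c n z" "in_box a b c n z'" "\<forall>i<2 * n. z i \<le> z' i" for z z'
    by (rule angelesco_image_mono(1)[OF w w one one that T[OF that(1)] T[OF that(2)]])
  define S where "S = {z. in_box a b c n z \<and> (\<forall>i<2 * n. z i \<le> T z i)}"
  have z0S: "z0 \<in> S" using z0 up[OF T[OF z0]] by (simp add: S_def)
  define Z where "Z = (\<lambda>i. SUP z\<in>S. z i)"
  have ac: "a < b" "b < c" using w by (auto simp: weight_on_def)
  have bdd: "bdd_above ((\<lambda>z. z i) ` S)" if "i < 2 * n" for i
  proof (rule bdd_aboveI2)
    fix z assume "z \<in> S"
    then have "\<forall>i<2 * n. z i \<le> c"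
      using ac unfolding all_less_double by (auto simp: S_def in_box_def intro: order.trans)
    then show "z i \<le> c" using that by simp
  qed
  have leZ: "z i \<le> Z i" if "z \<in> S" "i < 2 * n" for z i
    unfolding Z_def using that by (intro cSUP_upper bdd)
  have Z_least: "Z i \<le> B" if "\<And>z. z \<in> S \<Longrightarrow> z i \<le> B" for i B
    unfolding Z_def using z0S that by (intro cSUP_least) auto
  have Z_box: "in_box a b c n Z"
    unfolding in_box_def
  proof (intro allI impI)
    fix i assume i: "i < n"
    have "Z i \<le> b" "Z (n + i) \<le> c"
      using i by (intro Z_least; auto simp: S_def in_box_def)+
    moreover have "a \<le> Z i" "b \<le> Z (n + i)"
      using i z0 leZ[OF z0S, of i] leZ[OF z0S, of "n + i"] by (auto simp: in_box_def intro: order.trans)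
    ultimately show "Z i \<in> {a..b} \<and> Z (n + i) \<in> {b..c}" by simp
  qed
  have le1: "Z i \<le> T Z i" if "i < 2 * n" for i
  proof (rule Z_least)
    fix z assume z: "z \<in> S"
    then have "z i \<le> T z i" using that by (simp add: S_def)
    also have "T z i \<le> T Z i"
      using T_mono[of z Z] z Z_box leZ[OF z] that by (simp add: S_def)
    finally show "z i \<le> T Z i" .
  qed
  have "T Z \<in> S"
    unfolding S_def using T_box[OF Z_box] T_mono[OF Z_box T_box[OF Z_box]] le1 by simp
  then have "T Z i = Z i" if "i < 2 * n" for i
    using le1[OF that] leZ[OF _ that] by (intro antisym) auto
  then have "angelesco_image a b c w n Z Z"
    using T[OF Z_box] angelesco_image_cong[of n "T Z" Z Z Z] by simp
  then show ?thesis using leZ[OF z0S] by blast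
qed

text \<open>
  The least element of the box lies below its image.
\<close>

lemma angelesco_nodes_exist:
  assumes w: "weight_on a b w" "weight_on b c w"
  shows "\<exists>z. angelesco_image a b c w n z z"
proof -
  define z0 :: "nat \<Rightarrow> real" where "z0 = (\<lambda>i. if i < n then a else b)"
  have box: "in_box a b c n z0" using w by (auto simp: in_box_def z0_def weight_on_def)
  have "\<exists>z. angelesco_image a b c w n z z \<and> (\<forall>i<2 * n. z0 i \<le> z i)"
  proof (rule angelesco_fixpoint_above[OF w box])
    fix u assume "angelesco_image a b c w n z0 u"
    then have "in_box a b c n u" by (rule angelesco_image_in_box)
    then show "\<forall>i<2 * n. z0 i \<le> u i"
      unfolding all_less_double by (auto simp: in_box_def z0_def)
  qed
  then show ?thesis by blast
qed

lemma vanishing_moments_scale: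
  "vanishing_moments c d n g \<Longrightarrow> vanishing_moments c d n (\<lambda>x. k * g x)"
  by (simp add: vanishing_moments_def mult.left_commute[of _ k])

text \<open>
  On the left interval \<open>P\<^sub>2\<close> has the constant sign \<open>(-1)\<^sup>n\<close>, so replacing \<open>\<bar>P\<^sub>2\<bar>\<close> by \<open>P\<^sub>2\<close> does not
  affect the vanishing of the moments.
\<close>

lemma angelesco_nodes_poly:
  assumes z: "angelesco_image a b c w n z z"
  shows "strict_mono_on {..<2 * n} z"
    and "vanishing_moments a b n (\<lambda>x. poly (node_poly (2 * n) z) x * w x)"
    and "vanishing_moments b c n (\<lambda>x. poly (node_poly (2 * n) z) x * w x)"
proof -
  have l: "orth_nodes a b (left_weight n z w) n z"
    and r: "orth_nodes b c (right_weight n z w) n (\<lambda>i. z (n + i))"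
    using z by (auto simp: angelesco_image_def)
  have split: "poly (node_poly (2 * n) z) x = (\<Prod>i<n. x - z i) * (\<Prod>i<n. x - z (n + i))" for x
    using prod_lessThan_add[of "\<lambda>i. x - z i" n n] by (simp add: mult_2)
  show "strict_mono_on {..<2 * n} z"
  proof (rule strict_mono_onI)
    fix i j assume ij: "i \<in> {..<2 * n}" "j \<in> {..<2 * n}" "i < j"
    consider "j < n" | "i < n" "n \<le> j" | "n \<le> i" by linarith
    then show "z i < z j"
    proof cases
      case 1
      have "strict_mono_on {..<n} z" using l by (simp add: orth_nodes_def)
      from strict_mono_onD[OF this, of i j] show ?thesis using 1 ij by simp
    next
      case 2
      then have "z i < b" using l by (simp add: orth_nodes_def)
      moreover have "\<forall>i<n. b < z (n + i)" using r by (simp add: orth_nodes_def)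
      then have "b < z (n + (j - n))" using 2 ij by (elim allE[of _ "j - n"]) auto
      ultimately show ?thesis using 2 by simp
    next
      case 3
      have "strict_mono_on {..<n} (\<lambda>i. z (n + i))" using r by (simp add: orth_nodes_def)
      from strict_mono_onD[OF this, of "i - n" "j - n"] show ?thesis using 3 ij by auto
    qed
  qed
  have "(\<Prod>i<n. x - z (n + i)) = (-1) ^ n * (\<Prod>i<n. z (n + i) - x)" for x
    using prod.distrib[of "\<lambda>_. -1" "\<lambda>i. z (n + i) - x" "{..<n}"] by simp
  then have "(\<lambda>x. poly (node_poly (2 * n) z) x * w x)
      = (\<lambda>x. (-1) ^ n * (poly (node_poly n z) x * left_weight n z w x))"
    unfolding split by (simp add: left_weight_def fun_eq_iff)
  then show "vanishing_moments a b n (\<lambda>x. poly (node_poly (2 * n) z) x * w x)"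
    using l by (simp add: orth_nodes_def vanishing_moments_scale)
  have "(\<lambda>x. poly (node_poly (2 * n) z) x * w x)
      = (\<lambda>x. poly (node_poly n (\<lambda>i. z (n + i))) x * right_weight n z w x)"
    unfolding split by (simp add: right_weight_def fun_eq_iff)
  then show "vanishing_moments b c n (\<lambda>x. poly (node_poly (2 * n) z) x * w x)"
    using r by (simp add: orth_nodes_def)
qed

lemma vanishing_moments_diff:
  assumes f: "ioo_integrable c d f" and g: "ioo_integrable c d g"
    and "vanishing_moments c d n f" "vanishing_moments c d n g"
  shows "vanishing_moments c d n (\<lambda>x. f x - g x)"
  unfolding vanishing_moments_def
proof (intro allI impI)
  fix k assume "k < n"
  have "ioo_integrable c d (\<lambda>x. x ^ k * f x)" "ioo_integrable c d (\<lambda>x. x ^ k * g x)"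
    using set_integrable_poly_mult[OF f, of "monom 1 k"] set_integrable_poly_mult[OF g, of "monom 1 k"]
    by (simp_all add: poly_monom)
  from set_integral_diff(2)[OF this] show "ioo_integral c d (\<lambda>x. x ^ k * (f x - g x)) = 0"
    using assms(3,4) \<open>k < n\<close> by (simp add: vanishing_moments_def right_diff_distrib)
qed

text \<open>
  The difference of two solutions has degree less than \<open>2 n\<close>, but by orthogonality it has at least
  \<open>n\<close> zeros in each interval.
\<close>

lemma angelesco_poly_unique:
  assumes w: "weight_on a b w" "weight_on b c w"
    and p: "lead_coeff p = 1" "degree p = 2 * n"
      "vanishing_moments a b n (\<lambda>x. poly p x * w x)" "vanishing_moments b c n (\<lambda>x. poly p x * w x)"
    and q: "lead_coeff q = 1" "degree q = 2 * n"
      "vanishing_moments a b n (\<lambda>x. poly q x * w x)" "vanishing_moments b c n (\<lambda>x. poly q x * w x)"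
  shows "p = q"
proof (rule ccontr)
  assume "p \<noteq> q"
  define r where "r = p - q"
  have r0: "r \<noteq> 0" using \<open>p \<noteq> q\<close> by (simp add: r_def)
  have "coeff r (2 * n) = 0" using p q by (simp add: r_def)
  moreover have "degree r \<le> 2 * n" unfolding r_def using p q by (intro degree_diff_le) auto
  ultimately have deg: "degree r < 2 * n"
    using r0 by (metis le_neq_implies_less leading_coeff_0_iff)
  have "vanishing_moments a b n (\<lambda>x. poly r x * w x)" "vanishing_moments b c n (\<lambda>x. poly r x * w x)"
    using vanishing_moments_diff[OF weight_on_integrable weight_on_integrable, OF w(1) w(1) p(3) q(3)]
      vanishing_moments_diff[OF weight_on_integrable weight_on_integrable, OF w(2) w(2) p(4) q(4)]
    by (simp_all add: r_def left_diff_distrib)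
  then have cards: "n \<le> card {x \<in> {a<..<b}. poly r x = 0}" "n \<le> card {x \<in> {b<..<c}. poly r x = 0}"
    using vanishing_moments_poly_roots w r0 by auto
  have fin: "finite {x. poly r x = 0}" by (rule poly_roots_finite[OF r0])
  have "card ({x \<in> {a<..<b}. poly r x = 0} \<union> {x \<in> {b<..<c}. poly r x = 0})
      = card {x \<in> {a<..<b}. poly r x = 0} + card {x \<in> {b<..<c}. poly r x = 0}"
    by (rule card_Un_disjoint) (auto intro: finite_subset[OF _ fin])
  moreover have "card ({x \<in> {a<..<b}. poly r x = 0} \<union> {x \<in> {b<..<c}. poly r x = 0}) \<le> card {x. poly r x = 0}"
    by (intro card_mono fin) auto
  moreover have "card {x. poly r x = 0} \<le> degree r" by (rule card_poly_roots_bound[OF r0])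
  ultimately show False using cards deg by linarith
qed

lemma sorted_roots_node_poly:
  assumes "strict_mono_on {..<m} z"
  shows "sorted_list_of_set {x. poly (node_poly m z) x = 0} = map z [0..<m]"
proof -
  have "{x. poly (node_poly m z) x = 0} = set (map z [0..<m])"
    by (auto simp: image_iff)
  moreover have "sorted_wrt (<) (map z [0..<m])"
    using assms by (auto simp: sorted_wrt_map sorted_wrt_iff_nth_less strict_mono_on_def)
  ultimately show ?thesis
    by (metis sorted_list_of_set.idem_if_sorted_distinct strict_sorted_iff)
qed

lemma angelesco_nodes_unique:
  assumes w: "weight_on a b w" "weight_on b c w"
    and z: "angelesco_image a b c w n z z" and u: "angelesco_image a b c w n u u"
  shows "\<forall>i<2 * n. z i = u i"
proof -
  note z' = angelesco_nodes_poly[OF z] and u' = angelesco_nodes_poly[OF u]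
  have "node_poly (2 * n) z = node_poly (2 * n) u"
    by (rule angelesco_poly_unique[OF w _ _ z'(2,3) _ _ u'(2,3)]) simp_all
  then have "map z [0..<2 * n] = map u [0..<2 * n]"
    using sorted_roots_node_poly[OF z'(1)] sorted_roots_node_poly[OF u'(1)] by simp
  then show ?thesis by (auto simp: map_eq_conv)
qed

text \<open>
  The zeros \<open>x\<close> for \<open>v\<close> lie below their image under the map for \<open>w\<close>, so \<open>x \<le> y\<close>; then \<open>x\<close> and \<open>y\<close>,
  as images of themselves, compare strictly.
\<close>

theorem angelesco_zeros_strict_mono:
  fixes r :: "real \<Rightarrow> real"
  assumes v: "weight_on a b v" "weight_on b c v" and w: "weight_on a b w" "weight_on b c w"
    and rl: "\<forall>t\<in>{a<..<b}. w t = r t * v t" "strict_mono_on {a<..<b} r"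
    and rr: "\<forall>t\<in>{b<..<c}. w t = r t * v t" "strict_mono_on {b<..<c} r"
    and x: "angelesco_image a b c v n x x" and y: "angelesco_image a b c w n y y"
  shows "\<forall>i<2 * n. x i < y i"
proof -
  have ml: "mono_on {a<..<b} r" and mr: "mono_on {b<..<c} r"
    using rl(2) rr(2) strict_mono_on_imp_mono_on by blast+
  have box: "in_box a b c n x" "in_box a b c n y"
    using x y by (auto intro: angelesco_image_in_box)
  have "\<exists>z. angelesco_image a b c w n z z \<and> (\<forall>i<2 * n. x i \<le> z i)"
  proof (rule angelesco_fixpoint_above[OF w box(1)])
    fix u assume u: "angelesco_image a b c w n x u"
    show "\<forall>i<2 * n. x i \<le> u i"
      by (rule angelesco_image_mono(1)[OF v w rl(1) ml rr(1) mr box(1,1) _ x u]) simp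
  qed
  then obtain z where z: "angelesco_image a b c w n z z" "\<forall>i<2 * n. x i \<le> z i" by blast
  have "\<forall>i<2 * n. x i \<le> y i"
    using z(2) angelesco_nodes_unique[OF w z(1) y] by simp
  then show ?thesis
    by (rule angelesco_image_mono(2)[OF v w rl(1) ml rr(1) mr box _ x y rl(2) rr(2)])
qed

section \<open>A sign rule for real exponents\<close>

text \<open>
  Generalised polynomials, with real exponents. An exponent may occur several times.
\<close>

definition gpoly :: "'i set \<Rightarrow> ('i \<Rightarrow> real) \<Rightarrow> ('i \<Rightarrow> real) \<Rightarrow> real \<Rightarrow> real" where
  "gpoly I a e t = (\<Sum>i\<in>I. a i * t powr e i)"

lemma gpoly_has_derivative:
  assumes "0 < t"
  shows "(gpoly I a e has_real_derivative gpoly I (\<lambda>i. a i * e i) (\<lambda>i. e i - 1) t) (at t)"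
proof -
  have "((\<lambda>t. \<Sum>i\<in>I. a i * t powr e i) has_real_derivative
      (\<Sum>i\<in>I. a i * (e i * t powr (e i - 1)))) (at t)"
    by (intro DERIV_sum DERIV_cmult has_real_derivative_powr assms)
  then show ?thesis by (simp add: gpoly_def[abs_def] mult.assoc)
qed

lemma gpoly_shift:
  assumes "0 < t"
  shows "gpoly I a (\<lambda>i. e i - \<sigma>) t = t powr (- \<sigma>) * gpoly I a e t"
proof -
  have "t powr (e i - \<sigma>) = t powr (- \<sigma>) * t powr e i" for i
    by (simp flip: powr_add)
  then show ?thesis by (simp add: gpoly_def sum_distrib_left mult_ac)
qed

text \<open>
  The points between consecutive zeros given by Rolle's theorem are distinct from the zeros
  themselves; this is what makes an additional double zero countable in
  \<open>gpoly_sign_rule_double_zero\<close>.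
\<close>

lemma rolle_zeros:
  fixes f f' :: "real \<Rightarrow> real"
  assumes "finite A" "A \<subseteq> {0<..}" "\<forall>x\<in>A. f x = 0"
    and der: "\<And>x. 0 < x \<Longrightarrow> (f has_real_derivative f' x) (at x)"
  shows "\<exists>B. finite B \<and> B \<subseteq> {0<..} \<and> B \<inter> A = {} \<and> (\<forall>x\<in>B. f' x = 0 \<and> (\<exists>y\<in>A. x < y)) \<and>
    card A \<le> card B + 1"
  using assms(1-3)
proof (induction A rule: finite_linorder_max_induct)
  case empty
  then show ?case by (intro exI[of _ "{}"]) auto
next
  case (insert b A)
  show ?case
  proof (cases "A = {}")
    case True
    then show ?thesis by (intro exI[of _ "{}"]) auto
  next
    case False
    define m where "m = Max A"
    have mA: "m \<in> A" and mmax: "\<And>x. x \<in> A \<Longrightarrow> x \<le> m"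
      using False insert.hyps by (auto simp: m_def)
    have mb: "m < b" and m0: "0 < m" using mA insert.hyps insert.prems by auto
    have sub: "A \<subseteq> {0<..}" "\<forall>x\<in>A. f x = 0" using insert.prems by auto
    from insert.IH[OF sub] obtain B where B: "finite B" "B \<subseteq> {0<..}" "B \<inter> A = {}"
      "\<forall>x\<in>B. f' x = 0 \<and> (\<exists>y\<in>A. x < y)" "card A \<le> card B + 1"
      by (elim exE conjE)
    have fm: "f m = f b" using mA insert.prems by simp
    have cont: "continuous_on {m..b} f"
      by (intro continuous_at_imp_continuous_on ballI DERIV_isCont[OF der]) (use m0 in auto)
    have hd: "(f has_derivative (\<lambda>v. v * f' x)) (at x)" if "m < x" "x < b" for x
      using der[of x] that m0 by (simp add: has_field_derivative_def mult.commute[of _ "f' x"])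
    obtain \<xi> where \<xi>: "m < \<xi>" "\<xi> < b" "(\<lambda>v. v * f' \<xi>) = (\<lambda>v. 0)"
      using Rolle_deriv[OF mb fm cont hd] by auto
    from fun_cong[OF \<xi>(3), of 1] have der0: "f' \<xi> = 0" by simp
    have Bm: "x < m" if "x \<in> B" for x using B(4) that mmax by (meson less_le_trans)
    have "\<xi> \<notin> B" using Bm \<xi>(1) by (meson less_asym)
    then have "card (insert b A) \<le> card (insert \<xi> B) + 1"
      using B(1,5) insert.hyps by (auto simp: card_insert_if)
    moreover have "\<xi> \<notin> A" using mmax \<xi>(1) by (meson leD)
    moreover have "b \<notin> B" using Bm mb by (meson less_asym)
    ultimately show ?thesis
      using B \<xi> der0 m0 by (intro exI[of _ "insert \<xi> B"]) auto
  qed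
qed

text \<open>
  Rolle's theorem for \<open>t\<^sup>-\<^sup>\<sigma>\<close> times the generalised polynomial, which has the same positive zeros.
\<close>

lemma gpoly_rolle:
  assumes "finite A" "A \<subseteq> {0<..}" "\<forall>x\<in>A. gpoly I a e x = 0"
  shows "\<exists>B. finite B \<and> B \<subseteq> {0<..} \<and> B \<inter> A = {} \<and> card A \<le> card B + 1 \<and>
    (\<forall>x\<in>B. gpoly I (\<lambda>i. a i * (e i - \<sigma>)) (\<lambda>i. e i - \<sigma> - 1) x = 0)"
proof -
  have "\<forall>x\<in>A. gpoly I a (\<lambda>i. e i - \<sigma>) x = 0"
    using assms(2,3) by (auto simp: gpoly_shift)
  from rolle_zeros[OF assms(1,2) this gpoly_has_derivative] show ?thesis by blast
qed

text \<open>
  Descartes' rule of signs, with the sign changes encoded by separating points: the assumption says that the sign of \<open>a i\<close> is that of \<open>\<Prod>j<m. e i - s j\<close>, so it changes at most at the \<open>m\<close> points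
  \<open>s j\<close> as the exponent grows. Differentiating \<open>t powr (- s m) * gpoly I a e t\<close> multiplies \<open>a i\<close>
  by \<open>e i - s m\<close>, which removes one of these points and, by Rolle's theorem, at most one zero.
\<close>

lemma gpoly_sign_rule:
  assumes "finite I" "I \<noteq> {}" "\<forall>i\<in>I. 0 < a i * (\<Prod>j<m. e i - s j)"
  shows "finite {t. 0 < t \<and> gpoly I a e t = 0} \<and> card {t. 0 < t \<and> gpoly I a e t = 0} \<le> m"
  using assms(3)
proof (induction m arbitrary: a e s)
  case 0
  have "0 < gpoly I a e t" if "0 < t" for t
    unfolding gpoly_def
  proof (rule sum_pos[OF assms(1,2)])
    fix i assume "i \<in> I"
    then have "0 < a i" using 0 by simp
    then show "0 < a i * t powr e i" using that by simp
  qed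
  then have "{t. 0 < t \<and> gpoly I a e t = 0} = {}" by force
  then show ?case by (simp only: finite.emptyI card.empty order.refl simp_thms)
next
  case (Suc m)
  define a' where "a' = (\<lambda>i. a i * (e i - s m))"
  define e' where "e' = (\<lambda>i. e i - s m - 1)"
  have "\<forall>i\<in>I. 0 < a' i * (\<Prod>j<m. e' i - (s j - s m - 1))"
    using Suc.prems by (simp add: a'_def e'_def mult.assoc mult.commute[of "_ - s m"])
  from Suc.IH[OF this] have IH: "finite {t. 0 < t \<and> gpoly I a' e' t = 0}"
    "card {t. 0 < t \<and> gpoly I a' e' t = 0} \<le> m" by auto
  show ?case
  proof (rule finite_if_finite_subsets_card_bdd)
    fix A assume A: "A \<subseteq> {t. 0 < t \<and> gpoly I a e t = 0}" "finite A"
    then have "A \<subseteq> {0<..}" "\<forall>x\<in>A. gpoly I a e x = 0" by auto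
    from gpoly_rolle[OF A(2) this, of "s m"]
    obtain B where B: "B \<subseteq> {0<..}" "card A \<le> card B + 1" "\<forall>x\<in>B. gpoly I a' e' x = 0"
      unfolding a'_def e'_def by blast
    have "card B \<le> card {t. 0 < t \<and> gpoly I a' e' t = 0}"
      using B by (intro card_mono IH) auto
    with B(2) IH(2) show "card A \<le> Suc m" by linarith
  qed
qed

text \<open>
  A double zero is a zero of the derivative used in the induction step of the sign rule, in addition
  to the zeros between consecutive ones.
\<close>

lemma gpoly_sign_rule_double_zero:
  assumes I: "finite I" "I \<noteq> {}" and a: "\<forall>i\<in>I. 0 < a i * (\<Prod>j<Suc m. e i - s j)"
    and t0: "0 < t0" "gpoly I a e t0 = 0" "(gpoly I a e has_real_derivative 0) (at t0)"
  shows "card {t. 0 < t \<and> gpoly I a e t = 0} \<le> m"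
proof -
  define A where "A = {t. 0 < t \<and> gpoly I a e t = 0}"
  define a' where "a' = (\<lambda>i. a i * (e i - s m))"
  define e' where "e' = (\<lambda>i. e i - s m - 1)"
  have "\<forall>i\<in>I. 0 < a' i * (\<Prod>j<m. e' i - (s j - s m - 1))"
    using a by (simp add: a'_def e'_def mult.assoc mult.commute[of "_ - s m"])
  from gpoly_sign_rule[OF I this] have IH: "finite {t. 0 < t \<and> gpoly I a' e' t = 0}"
    "card {t. 0 < t \<and> gpoly I a' e' t = 0} \<le> m" by auto
  have A: "finite A" "A \<subseteq> {0<..}" "\<forall>x\<in>A. gpoly I a e x = 0"
    using gpoly_sign_rule[OF I a] by (auto simp: A_def)
  from gpoly_rolle[OF A, of "s m"]
  obtain B where B: "finite B" "B \<subseteq> {0<..}" "B \<inter> A = {}" "card A \<le> card B + 1"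
      "\<forall>x\<in>B. gpoly I a' e' x = 0"
    unfolding a'_def e'_def by blast
  have "(gpoly I a (\<lambda>i. e i - s m) has_real_derivative gpoly I a' e' t0) (at t0)"
    unfolding a'_def e'_def by (rule gpoly_has_derivative[OF t0(1)])
  moreover have "(gpoly I a (\<lambda>i. e i - s m) has_real_derivative 0) (at t0)"
  proof -
    have "((\<lambda>t. t powr (- s m) * gpoly I a e t) has_real_derivative
        (- s m * t0 powr (- s m - 1)) * gpoly I a e t0 + 0 * t0 powr (- s m)) (at t0)"
      by (intro DERIV_mult has_real_derivative_powr t0)
    then have "((\<lambda>t. t powr (- s m) * gpoly I a e t) has_real_derivative 0) (at t0)"
      using t0(2) by simp
    then show ?thesis
    proof (rule has_field_derivative_transform_within_open)
      show "open {0::real<..}" "t0 \<in> {0<..}" using t0(1) by auto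
    qed (simp add: gpoly_shift)
  qed
  ultimately have "gpoly I a' e' t0 = 0" by (rule DERIV_unique)
  then have "insert t0 B \<subseteq> {t. 0 < t \<and> gpoly I a' e' t = 0}" using B t0(1) by auto
  from card_mono[OF IH(1) this] have "card (insert t0 B) \<le> m" using IH(2) by simp
  moreover have "t0 \<notin> B" using B(3) t0(1,2) by (auto simp: A_def)
  ultimately show ?thesis using B(1,4) by (simp add: A_def)
qed

lemma sign_prod_differences:
  fixes e :: real
  assumes "k \<le> m" "\<And>j. j < k \<Longrightarrow> s j < e" "\<And>j. k \<le> j \<Longrightarrow> j < m \<Longrightarrow> e < s j"
  shows "0 < (-1) ^ (m - k) * (\<Prod>j<m. e - s j)"
proof -
  have "(\<Prod>j<k + (m - k). e - s j) = (\<Prod>j<k. e - s j) * (\<Prod>j<m - k. e - s (k + j))"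
    by (rule prod_lessThan_add)
  also have "(\<Prod>j<m - k. e - s (k + j)) = (-1) ^ (m - k) * (\<Prod>j<m - k. s (k + j) - e)"
    using prod.distrib[of "\<lambda>_. -1" "\<lambda>j. s (k + j) - e" "{..<m - k}"] by simp
  finally have "(-1) ^ (m - k) * (\<Prod>j<m. e - s j) = (\<Prod>j<k. e - s j) * (\<Prod>j<m - k. s (k + j) - e)"
    using assms(1) by (simp flip: power_mult_distrib)
  also have "\<dots> > 0"
    using assms by (intro mult_pos_pos prod_pos) auto
  finally show ?thesis .
qed

lemma same_sign_mult:
  fixes x y :: real
  assumes "0 < (-1) ^ k * x" "0 < (-1) ^ k * y"
  shows "0 < x * y"
  using assms by (cases "even k") (auto simp: mult_neg_neg)

lemma sign_coeff_node_poly: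
  assumes "\<And>j. j < n \<Longrightarrow> 0 < u j" "i \<le> n"
  shows "0 < (-1) ^ (n - i) * coeff (node_poly n u) i"
  using assms
proof (induction n arbitrary: i)
  case 0
  then show ?case by (simp add: node_poly_def)
next
  case (Suc n)
  have rec: "node_poly (Suc n) u = [:- u n, 1:] * node_poly n u"
    by (simp add: node_poly_def mult.commute)
  have c: "coeff (node_poly (Suc n) u) i = (case i of 0 \<Rightarrow> 0 | Suc i' \<Rightarrow> coeff (node_poly n u) i') - u n * coeff (node_poly n u) i"
    unfolding rec by (simp add: coeff_pCons split: nat.split)
  have low: "0 < (-1) ^ (Suc n - i) * (- u n * coeff (node_poly n u) i)" if "i \<le> n"
    using Suc.IH[OF _ that] Suc.prems(1) that
    by (auto simp: Suc_diff_le mult.left_commute[of _ "u n"])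
  show ?case
  proof (cases i)
    case 0
    then show ?thesis using low c by simp
  next
    case (Suc i')
    have "0 < (-1) ^ (Suc n - i) * coeff (node_poly n u) i'"
      using Suc.IH[of i'] Suc.prems Suc by simp
    moreover have "0 < (-1) ^ (Suc n - i) * (- u n * coeff (node_poly n u) i) \<or> i = Suc n"
      using low Suc.prems(2) by linarith
    ultimately show ?thesis
      using Suc c by (auto simp: right_diff_distrib coeff_eq_0)
  qed
qed

section \<open>The pencil of two even polynomials\<close>

text \<open>
  For \<open>c = 0\<close> and \<open>c = \<infinity>\<close> the zeros are those of \<open>q\<close> and of \<open>p\<close>; in the main application
  \<open>p\<close> and \<open>q\<close> have as zeros the squares of the positive zeros for the two values of \<open>\<beta>\<close>.
\<close>

definition pencil :: "real \<Rightarrow> real poly \<Rightarrow> real poly \<Rightarrow> real \<Rightarrow> real \<Rightarrow> real" where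
  "pencil d p q c t = t powr d * poly q t - c * poly p t"

lemma pencil_eq_gpoly:
  assumes "degree p = n" "degree q = n" "0 < t"
  shows "pencil d p q c t = gpoly ({..n} <+> {..n})
    (case_sum (\<lambda>i. coeff q i) (\<lambda>i. - c * coeff p i)) (case_sum (\<lambda>i. real i + d) real) t"
proof -
  have "t powr d * poly q t = (\<Sum>i\<le>n. coeff q i * t powr (real i + d))"
    unfolding poly_altdef assms(2) using assms(3)
    by (simp add: powr_add powr_realpow sum_distrib_left mult_ac)
  moreover have "c * poly p t = (\<Sum>i\<le>n. c * coeff p i * t powr real i)"
    unfolding poly_altdef assms(1) using assms(3)
    by (simp add: powr_realpow sum_distrib_left mult_ac)
  ultimately show ?thesis
    by (simp add: pencil_def gpoly_def sum.Plus sum_negf)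
qed

lemma pencil_has_derivative:
  assumes "0 < t"
  shows "(pencil d p q c has_real_derivative
    t powr d * (d * poly q t / t + poly (pderiv q) t) - c * poly (pderiv p) t) (at t)"
proof -
  have "((\<lambda>t. t powr d * poly q t - c * poly p t) has_real_derivative
      (d * t powr (d - 1)) * poly q t + poly (pderiv q) t * t powr d - c * poly (pderiv p) t) (at t)"
    by (intro DERIV_diff DERIV_mult DERIV_cmult has_real_derivative_powr poly_DERIV assms)
  moreover have "t powr (d - 1) = t powr d / t"
    using assms by (simp add: powr_diff)
  ultimately show ?thesis
    by (simp add: pencil_def[abs_def] algebra_simps)
qed

text \<open>
  The sign rule for the exponents \<open>0 < d < 1 < 1 + d < \<dots> < n < n + d\<close>. The coefficients of \<open>p\<close>
  and \<open>q\<close> alternate. If \<open>c < 0\<close>, then \<open>i\<close> and \<open>i + d\<close> carry equal signs, and the sign changes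
  happen between \<open>i + d\<close> and \<open>i + 1\<close>. If \<open>c > 0\<close>, then \<open>i + d\<close> and \<open>i + 1\<close> carry equal signs,
  and the sign changes happen between \<open>i\<close> and \<open>i + d\<close>, once more than before.
\<close>

lemma pencil_zeros:
  fixes u v :: "nat \<Rightarrow> real"
  assumes d: "0 < d" "d < 1" and u: "\<And>i. i < n \<Longrightarrow> 0 < u i" and v: "\<And>i. i < n \<Longrightarrow> 0 < v i"
    and c: "c \<noteq> 0"
  defines "H \<equiv> pencil d (node_poly n u) (node_poly n v) c"
  defines "m \<equiv> (if c < 0 then n else Suc n)"
  shows "finite {t. 0 < t \<and> H t = 0}" and "card {t. 0 < t \<and> H t = 0} \<le> m"
    and "0 < t0 \<Longrightarrow> H t0 = 0 \<Longrightarrow> (H has_real_derivative 0) (at t0) \<Longrightarrow> card {t. 0 < t \<and> H t = 0} \<le> m - 1"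
proof -
  define I where "I = {..n} <+> {..n}"
  define a where "a = case_sum (\<lambda>i. coeff (node_poly n v) i) (\<lambda>i. - c * coeff (node_poly n u) i)"
  define e where "e = case_sum (\<lambda>i. real i + d) real"
  have H: "H t = gpoly I a e t" if "0 < t" for t
    unfolding H_def I_def a_def e_def by (rule pencil_eq_gpoly) (simp_all add: that)
  have zeros: "{t. 0 < t \<and> H t = 0} = {t. 0 < t \<and> gpoly I a e t = 0}" using H by auto
  have I: "finite I" "I \<noteq> {}" by (auto simp: I_def)
  \<comment> \<open>the midpoints of the gaps between exponents at which the sign changes\<close>
  define s where "s = (\<lambda>j. real j + (if c < 0 then (1 + d) / 2 else d / 2))"
  have signs: "\<forall>i\<in>I. 0 < a i * (\<Prod>j<m. e i - s j)"
  proof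
    fix x assume "x \<in> I"
    then consider (q) i where "x = Inl i" "i \<le> n" | (p) i where "x = Inr i" "i \<le> n"
      by (auto simp: I_def)
    then show "0 < a x * (\<Prod>j<m. e x - s j)"
    proof cases
      case (q i)
      have "0 < (-1) ^ (n - i) * a x"
        using sign_coeff_node_poly[OF v q(2)] by (simp add: a_def q(1))
      moreover have "0 < (-1) ^ (n - i) * (\<Prod>j<m. e x - s j)"
      proof (cases "c < 0")
        case True
        then have "0 < (-1) ^ (m - i) * (\<Prod>j<m. e x - s j)"
          using d q by (intro sign_prod_differences) (auto simp: s_def e_def m_def field_simps)
        then show ?thesis using True by (simp add: m_def)
      next
        case False
        then have "0 < (-1) ^ (m - Suc i) * (\<Prod>j<m. e x - s j)"
          using d q by (intro sign_prod_differences) (auto simp: s_def e_def m_def field_simps)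
        then show ?thesis using False by (simp add: m_def)
      qed
      ultimately show ?thesis by (rule same_sign_mult)
    next
      case (p i)
      have cu: "0 < (-1) ^ (n - i) * coeff (node_poly n u) i"
        by (rule sign_coeff_node_poly[OF u p(2)])
      have prod: "0 < (-1) ^ (m - i) * (\<Prod>j<m. e x - s j)"
        using d p by (intro sign_prod_differences) (auto simp: s_def e_def m_def field_simps)
      have "0 < (-1) ^ (m - i) * a x"
      proof (cases "c < 0")
        case True
        then have "0 < (- c) * ((-1) ^ (n - i) * coeff (node_poly n u) i)"
          using True by (intro mult_pos_pos[OF _ cu]) simp
        then show ?thesis using True by (simp add: a_def p(1) m_def mult_ac)
      next
        case False
        then have "0 < c * ((-1) ^ (n - i) * coeff (node_poly n u) i)"
          using False c by (intro mult_pos_pos[OF _ cu]) simp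
        then show ?thesis using False p(2) by (simp add: a_def p(1) m_def Suc_diff_le mult_ac)
      qed
      then show ?thesis using prod by (rule same_sign_mult)
    qed
  qed
  show "finite {t. 0 < t \<and> H t = 0}" "card {t. 0 < t \<and> H t = 0} \<le> m"
    using gpoly_sign_rule[OF I signs] unfolding zeros by auto
  assume t0: "0 < t0" "H t0 = 0" "(H has_real_derivative 0) (at t0)"
  have der: "(gpoly I a e has_real_derivative 0) (at t0)"
    using t0(3)
  proof (rule has_field_derivative_transform_within_open)
    show "open {0::real<..}" "t0 \<in> {0<..}" using t0(1) by auto
  qed (simp add: H)
  have g0: "gpoly I a e t0 = 0" using H[OF t0(1)] t0(2) by simp
  show "card {t. 0 < t \<and> H t = 0} \<le> m - 1"
  proof (cases m)
    case 0
    have "t0 \<in> {t. 0 < t \<and> gpoly I a e t = 0}" using t0(1) g0 by simp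
    moreover have "{t. 0 < t \<and> gpoly I a e t = 0} = {}"
      using gpoly_sign_rule[OF I signs] 0 by (metis card_0_eq le_zero_eq)
    ultimately show ?thesis by blast
  next
    case (Suc m')
    show ?thesis
      using gpoly_sign_rule_double_zero[OF I signs[unfolded Suc] t0(1) g0 der]
      unfolding zeros Suc by simp
  qed
qed

lemma node_poly_pos_large:
  assumes "\<And>i. i < n \<Longrightarrow> v i < 1" "2 \<le> (t::real)"
  shows "(t / 2) ^ n \<le> poly (node_poly n v) t"
proof -
  have "(\<Prod>i<n. t / 2) \<le> (\<Prod>i<n. t - v i)"
  proof (rule prod_mono)
    fix i assume "i \<in> {..<n}"
    then have "v i < 1" using assms(1) by simp
    then show "0 \<le> t / 2 \<and> t / 2 \<le> t - v i" using assms(2) by simp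
  qed
  then show ?thesis by simp
qed

lemma pencil_pos_large:
  assumes d: "0 < d" and u: "\<And>i. i < n \<Longrightarrow> 0 < u i \<and> u i < 1" and v: "\<And>i. i < n \<Longrightarrow> 0 < v i \<and> v i < 1"
    and c: "0 < c"
  obtains t where "1 < t" "0 < pencil d (node_poly n u) (node_poly n v) c t"
proof -
  \<comment> \<open>\<open>p t \<le> t ^ n\<close> and \<open>q t \<ge> (t / 2) ^ n\<close>, so \<open>t powr d > c * 2 ^ n\<close> suffices.\<close>
  define B where "B = c * 2 ^ n + 1"
  define t where "t = max 2 (B powr (1 / d))"
  have B: "0 < B" using c by (simp add: B_def add_pos_pos)
  have t2: "2 \<le> t" by (simp add: t_def)
  have "B = (B powr (1 / d)) powr d" using B d by (simp add: powr_powr)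
  also have "\<dots> \<le> t powr d" using d by (intro powr_mono2) (auto simp: t_def)
  finally have "c * 2 ^ n < t powr d" by (simp add: B_def)
  then have "c < t powr d / 2 ^ n" by (simp add: field_simps)
  then have "0 < t ^ n * (t powr d / 2 ^ n - c)" using t2 by simp
  also have "\<dots> = t powr d * (t / 2) ^ n - c * t ^ n" by (simp add: power_divide algebra_simps)
  also have "\<dots> \<le> t powr d * poly (node_poly n v) t - c * poly (node_poly n u) t"
  proof (rule diff_mono)
    show "t powr d * (t / 2) ^ n \<le> t powr d * poly (node_poly n v) t"
      using v t2 by (intro mult_left_mono node_poly_pos_large) auto
    have "(\<Prod>i<n. t - u i) \<le> (\<Prod>i<n. t)"
    proof (rule prod_mono)
      fix i assume "i \<in> {..<n}"
      then show "0 \<le> t - u i \<and> t - u i \<le> t" using u[of i] t2 by simp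
    qed
    then show "c * poly (node_poly n u) t \<le> c * t ^ n" using c by simp
  qed
  finally show thesis using t2 that[of t] by (simp add: pencil_def)
qed

lemma pencil_continuous:
  assumes "0 < d"
  shows "continuous_on {0..} (pencil d p q c)"
  unfolding pencil_def[abs_def] using assms by (intro continuous_intros continuous_on_powr') auto

text \<open>
  If \<open>c < 0\<close>, a double zero leaves room for only \<open>n - 1\<close> distinct zeros. If \<open>c > 0\<close> it leaves room
  for \<open>n\<close>, so that the zeros are exactly the \<open>n\<close> sign changes in \<open>(0, 1)\<close>. Then \<open>H\<close> would change
  sign exactly \<open>n\<close> times between \<open>0\<close>, where its sign is \<open>(-1)\<^sup>n\<^sup>+\<^sup>1\<close>, and a large argument, where it is
  positive; this has the wrong parity.
\<close>

lemma pencil_no_double_zero: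
  assumes d: "0 < d" "d < 1" and n: "0 < n"
    and u: "\<And>i. i < n \<Longrightarrow> 0 < u i \<and> u i < 1" and v: "\<And>i. i < n \<Longrightarrow> 0 < v i \<and> v i < 1"
    and c: "c \<noteq> 0"
  defines "H \<equiv> pencil d (node_poly n u) (node_poly n v) c"
  assumes Y: "Y \<subseteq> {t. 0 < t \<and> t < 1 \<and> H t = 0}" "n \<le> card Y"
    and s: "s \<in> {1, -1}" "\<forall>t\<in>{0<..<1}. 0 \<le> s * H t * (\<Prod>z\<in>Y. t - z)"
    and t0: "0 < t0" "H t0 = 0" "(H has_real_derivative 0) (at t0)"
  shows False
proof -
  define Z where "Z = {t. 0 < t \<and> H t = 0}"
  have up: "\<And>i. i < n \<Longrightarrow> 0 < u i" and vp: "\<And>i. i < n \<Longrightarrow> 0 < v i" using u v by auto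
  have finZ: "finite Z"
    unfolding Z_def H_def by (rule pencil_zeros(1)[OF d up vp c])
  have cardZ: "card Z \<le> (if c < 0 then n else Suc n) - 1"
    unfolding Z_def H_def by (rule pencil_zeros(3)[OF d up vp c t0[unfolded H_def]])
  have YZ: "Y \<subseteq> Z" using Y(1) by (auto simp: Z_def)
  have cY: "card Y \<le> card Z" by (rule card_mono[OF finZ YZ])
  have cpos: "0 < c"
  proof (rule ccontr)
    assume "\<not> 0 < c"
    then show False using c cardZ cY Y(2) n by simp
  qed
  then have "card Y = card Z" and cYn: "card Y = n" using cardZ cY Y(2) by simp_all
  then have YeqZ: "Y = Z" by (intro card_subset_eq finZ YZ)
  have finY: "finite Y" using finZ YeqZ by simp
  have Y0: "Y \<noteq> {}" using cYn n by auto
  have Y01: "0 < z" "z < 1" if "z \<in> Y" for z using Y(1) that by auto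
  have cont: "continuous_on {0..} H" unfolding H_def by (rule pencil_continuous[OF d(1)])
  have "poly (node_poly n u) 0 = (-1) ^ n * (\<Prod>i<n. u i)"
    using prod.distrib[of "\<lambda>_. -1" u "{..<n}"] by simp
  then have H0: "(-1) ^ n * H 0 = - c * (\<Prod>i<n. u i)"
    using d by (simp add: H_def pencil_def flip: power_mult_distrib)
  also have "\<dots> < 0" using mult_pos_pos[OF cpos prod_pos[of "{..<n}" u]] up by simp
  finally have H0neg: "(-1) ^ n * H 0 < 0" .
  have "continuous_on {0..} (\<lambda>t. (-1) ^ n * H t)" by (intro continuous_intros cont)
  then have "((\<lambda>t. (-1) ^ n * H t) \<longlongrightarrow> (-1) ^ n * H 0) (at 0 within {0..})"
    by (simp add: continuous_on)
  then have "eventually (\<lambda>t. (-1) ^ n * H t < 0) (at 0 within {0..})"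
    using H0neg by (rule order_tendstoD(2))
  then obtain \<epsilon> where \<epsilon>: "0 < \<epsilon>" "\<And>t. 0 < t \<Longrightarrow> t < \<epsilon> \<Longrightarrow> (-1) ^ n * H t < 0"
    unfolding eventually_at by (auto simp: dist_real_def)
  \<comment> \<open>A point to the left of all zeros fixes the sign factor \<open>s\<close>.\<close>
  define t1 where "t1 = min \<epsilon> (Min Y) / 2"
  have minY: "Min Y \<in> Y" "\<And>z. z \<in> Y \<Longrightarrow> Min Y \<le> z" using finY Y0 by auto
  have t1: "0 < t1" "t1 < \<epsilon>" "\<And>z. z \<in> Y \<Longrightarrow> t1 < z"
    using \<epsilon>(1) Y01[OF minY(1)] minY(2) by (force simp: t1_def min_def)+
  have "t1 < 1" using t1(3)[OF minY(1)] Y01[OF minY(1)] by simp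
  have "(\<Prod>z\<in>Y. t1 - z) = (-1) ^ n * (\<Prod>z\<in>Y. z - t1)"
    using prod.distrib[of "\<lambda>_. -1" "\<lambda>z. z - t1" Y] cYn by simp
  then have "s * H t1 * (\<Prod>z\<in>Y. t1 - z) = s * (((-1) ^ n * H t1) * (\<Prod>z\<in>Y. z - t1))"
    by simp
  moreover have "((-1) ^ n * H t1) * (\<Prod>z\<in>Y. z - t1) < 0"
    using t1(3) by (intro mult_neg_pos[OF \<epsilon>(2)[OF t1(1,2)]] prod_pos) auto
  moreover have "0 \<le> s * H t1 * (\<Prod>z\<in>Y. t1 - z)"
    using s(2) t1(1) \<open>t1 < 1\<close> by simp
  ultimately have "s \<noteq> 1" by (metis leD mult_1)
  then have sm: "s = -1" using s(1) by simp
  \<comment> \<open>To the right of all zeros this sign contradicts the growth of the pencil.\<close>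
  define t2 where "t2 = (Max Y + 1) / 2"
  have maxY: "Max Y \<in> Y" "\<And>z. z \<in> Y \<Longrightarrow> z \<le> Max Y" using finY Y0 by auto
  have t2: "Max Y < t2" "t2 < 1" "0 < t2" using Y01[OF maxY(1)] by (auto simp: t2_def)
  have "0 < (\<Prod>z\<in>Y. t2 - z)" using t2(1) maxY(2) by (intro prod_pos) fastforce
  moreover have "0 \<le> s * H t2 * (\<Prod>z\<in>Y. t2 - z)" using s(2) t2 by simp
  ultimately have "H t2 \<le> 0" using sm by (simp add: mult_le_0_iff)
  obtain T where T: "1 < T" "0 < H T"
    unfolding H_def by (rule pencil_pos_large[OF d(1) u v cpos])
  have "\<exists>x\<ge>t2. x \<le> T \<and> H x = 0"
    using \<open>H t2 \<le> 0\<close> T t2 by (intro IVT' continuous_on_subset[OF cont]) auto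
  then obtain x where x: "t2 \<le> x" "H x = 0" by blast
  then have "x \<in> Y" using t2 YeqZ by (simp add: Z_def)
  then show False using maxY(2)[of x] x(1) t2(1) by simp
qed

text \<open>
  The Wronskian of \<open>p\<close> and \<open>t\<^sup>d q\<close> is \<open>t\<^sup>d\<^sup>-\<^sup>1\<close> times this polynomial.
\<close>

definition pencil_wronskian :: "real \<Rightarrow> real poly \<Rightarrow> real poly \<Rightarrow> real poly" where
  "pencil_wronskian d p q = smult d (p * q) + [:0, 1:] * (p * pderiv q - q * pderiv p)"

lemma poly_pencil_wronskian:
  "poly (pencil_wronskian d p q) t =
    d * (poly p t * poly q t) + t * (poly p t * poly (pderiv q) t - poly q t * poly (pderiv p) t)"
  by (simp add: pencil_wronskian_def algebra_simps)

text \<open>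
  Where the Wronskian vanishes, the vectors of values and of derivatives of \<open>p\<close> and \<open>t\<^sup>d q\<close> are
  proportional, so a member of the pencil vanishes to second order. Simplicity of the zeros of \<open>p\<close>
  and \<open>q\<close> excludes the parameters \<open>c = \<infinity>\<close> and \<open>c = 0\<close>.
\<close>

lemma pencil_double_zero:
  assumes t: "0 < t" and V: "poly (pencil_wronskian d p q) t = 0"
    and p: "poly p t = 0 \<Longrightarrow> poly (pderiv p) t \<noteq> 0" and q: "poly q t = 0 \<Longrightarrow> poly (pderiv q) t \<noteq> 0"
  shows "\<exists>c. c \<noteq> 0 \<and> pencil d p q c t = 0 \<and> (pencil d p q c has_real_derivative 0) (at t)"
proof (cases "poly p t = 0")
  case True
  then have q0: "poly q t = 0"
    using V t p unfolding poly_pencil_wronskian by simp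
  define c where "c = t powr d * poly (pderiv q) t / poly (pderiv p) t"
  have "c \<noteq> 0" using p[OF True] q[OF q0] t by (simp add: c_def)
  moreover have "pencil d p q c t = 0" using True q0 by (simp add: pencil_def)
  moreover have "(pencil d p q c has_real_derivative 0) (at t)"
    using pencil_has_derivative[OF t, of d p q c] p[OF True] q0 by (simp add: c_def)
  ultimately show ?thesis by blast
next
  case False
  define c where "c = t powr d * poly q t / poly p t"
  have "poly q t \<noteq> 0"
  proof
    assume q0: "poly q t = 0"
    then show False using V t False q[OF q0] unfolding poly_pencil_wronskian by simp
  qed
  then have "c \<noteq> 0" using False t by (simp add: c_def)
  moreover have "pencil d p q c t = 0" using False by (simp add: pencil_def c_def)
  moreover have "t powr d * (d * poly q t / t + poly (pderiv q) t) - c * poly (pderiv p) t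
      = t powr d / (t * poly p t) * poly (pencil_wronskian d p q) t"
    unfolding poly_pencil_wronskian c_def using False t by (simp add: field_simps)
  then have "(pencil d p q c has_real_derivative 0) (at t)"
    using pencil_has_derivative[OF t, of d p q c] V by simp
  ultimately show ?thesis by blast
qed

lemma poly_pderiv_node_poly:
  assumes "k < n"
  shows "poly (pderiv (node_poly n u)) (u k) = (\<Prod>j\<in>{..<n} - {k}. u k - u j)"
proof -
  have "poly (pderiv (node_poly n u)) (u k) = (\<Sum>i<n. \<Prod>j\<in>{..<n} - {i}. u k - u j)"
    by (simp add: node_poly_def pderiv_prod poly_sum poly_prod pderiv_pCons)
  also have "\<dots> = (\<Sum>i<n. if i = k then (\<Prod>j\<in>{..<n} - {k}. u k - u j) else 0)"
    using assms by (intro sum.cong) auto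
  also have "\<dots> = (\<Prod>j\<in>{..<n} - {k}. u k - u j)"
    using assms by simp
  finally show ?thesis .
qed

lemma node_poly_simple_roots:
  assumes "inj_on u {..<n}" "poly (node_poly n u) t = 0"
  shows "poly (pderiv (node_poly n u)) t \<noteq> 0"
proof -
  obtain k where k: "k < n" "t = u k" using assms(2) by auto
  show ?thesis
    unfolding k(2) poly_pderiv_node_poly[OF k(1)]
    using assms(1) k(1) by (auto simp: inj_on_def)
qed

lemma sign_pderiv_node_poly:
  fixes u :: "nat \<Rightarrow> real"
  assumes "strict_mono_on {..<n} u" "k < n"
  shows "0 < (-1) ^ (n - Suc k) * poly (pderiv (node_poly n u)) (u k)"
proof -
  \<comment> \<open>the zeros other than \<open>u k\<close>\<close>
  define s where "s = (\<lambda>j. if j < k then u j else u (Suc j))"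
  have split: "{..<n} - {k} = {..<k} \<union> {Suc k..<n}" using assms(2) by auto
  have "(\<Prod>j\<in>{..<n} - {k}. u k - u j) = (\<Prod>j<k. u k - u j) * (\<Prod>j\<in>{Suc k..<n}. u k - u j)"
    unfolding split by (rule prod.union_disjoint) auto
  also have "(\<Prod>j\<in>{Suc k..<n}. u k - u j) = (\<Prod>j<n - Suc k. u k - u (Suc k + j))"
    using prod.shift_bounds_nat_ivl[of "\<lambda>j. u k - u j" 0 "Suc k" "n - Suc k"] assms(2)
    by (simp add: atLeast0LessThan add.commute)
  also have "(\<Prod>j<k. u k - u j) * \<dots> = (\<Prod>j<k + (n - Suc k). u k - s j)"
    unfolding prod_lessThan_add by (simp add: s_def)
  also have "k + (n - Suc k) = n - 1" using assms(2) by simp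
  finally have "poly (pderiv (node_poly n u)) (u k) = (\<Prod>j<n - 1. u k - s j)"
    using poly_pderiv_node_poly[OF assms(2)] by simp
  moreover have "0 < (-1) ^ (n - 1 - k) * (\<Prod>j<n - 1. u k - s j)"
    using assms by (intro sign_prod_differences) (auto simp: s_def intro!: strict_mono_onD[OF assms(1)])
  ultimately show ?thesis by simp
qed

text \<open>
  Let \<open>m k\<close> be the number of \<open>v j\<close> to the left of \<open>u k\<close>. The sign hypothesis says that \<open>m k\<close> and \<open>k\<close>
  have the same parity. Since \<open>m\<close> is nondecreasing and \<open>m (n - 1) \<le> n\<close>, parity gives \<open>m k \<le> k\<close>
  by descending induction, so \<open>v k\<close> is not to the left of \<open>u k\<close>.
\<close>

lemma sign_pattern_imp_less:
  fixes u v :: "nat \<Rightarrow> real"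
  assumes u: "strict_mono_on {..<n} u" and v: "strict_mono_on {..<n} v"
    and sgn: "\<And>k. k < n \<Longrightarrow> 0 < (-1) ^ (n - k) * poly (node_poly n v) (u k)"
    and k: "k < n"
  shows "u k < v k"
proof -
  define m where "m = (\<lambda>k. LEAST j. n \<le> j \<or> u k \<le> v j)"
  have m_spec: "n \<le> m k \<or> u k \<le> v (m k)" for k
    unfolding m_def by (rule LeastI[of _ n]) simp
  have m_le: "m k \<le> j" if "n \<le> j \<or> u k \<le> v j" for k j
    unfolding m_def using that by (rule Least_le)
  have m_n: "m k \<le> n" for k using m_le[of n k] by simp
  have below: "v j < u k" if "j < m k" for j k
    using m_le[of j k] that by linarith
  have ne: "u k \<noteq> v j" if "k < n" "j < n" for j k
  proof
    assume "u k = v j"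
    then have "poly (node_poly n v) (u k) = 0" using that(2) by auto
    with sgn[OF that(1)] show False by (metis mult_zero_right less_irrefl)
  qed
  have above: "u k < v j" if "k < n" "m k \<le> j" "j < n" for j k
  proof -
    have "u k \<le> v (m k)" using m_spec[of k] that by linarith
    also have "v (m k) \<le> v j" using strict_mono_onD[OF v, of "m k" j] that by (cases "m k = j") auto
    finally show ?thesis using ne[OF that(1,3)] by simp
  qed
  have parity: "even (m k) \<longleftrightarrow> even k" if "k < n" for k
  proof -
    have "0 < (-1) ^ (n - m k) * poly (node_poly n v) (u k)"
      using sign_prod_differences[of "m k" n v "u k"] m_n below above[OF that] by simp
    then have "even (n - m k) \<longleftrightarrow> even (n - k)"
      using sgn[OF that] by (cases "even (n - m k)"; cases "even (n - k)") auto
    then show ?thesis using m_n[of k] that by auto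
  qed
  have m_mono: "m k \<le> m (Suc k)" if "Suc k < n" for k
    using m_spec[of "Suc k"] strict_mono_onD[OF u, of k "Suc k"] that
    by (intro m_le) auto
  have "m (n - Suc i) \<le> n - Suc i" if "i < n" for i
    using that
  proof (induction i)
    case 0
    then show ?case using parity[of "n - 1"] m_n[of "n - 1"]
      by (cases "m (n - 1) = n") auto
  next
    case (Suc i)
    define j where "j = n - Suc (Suc i)"
    have j: "Suc j = n - Suc i" "Suc j < n" using Suc.prems by (auto simp: j_def)
    have "m j \<le> Suc j" using m_mono[OF j(2)] Suc.IH Suc.prems j(1) by simp
    moreover have "m j \<noteq> Suc j" using parity[of j] j(2) by auto
    ultimately show ?case by (simp add: j_def)
  qed
  from this[of "n - Suc k"] k have "m k \<le> k" by simp
  then show ?thesis using above[OF k _ k] by simp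
qed

text \<open>
  The combination \<open>H(x\<^sup>2)\<close> inherits the \<open>n\<close> vanishing moments from its two parts, because \<open>x\<^sup>2\<^sup>d w\<close> is the weight
  belonging to the second; its sign changes are carried over by \<open>x \<mapsto> x\<^sup>2\<close>.
\<close>

lemma symmetric_moments_pencil:
  fixes c :: real
  assumes d: "0 < d" and w: "weight_on 0 1 w"
    and x: "vanishing_moments 0 1 n (\<lambda>x. poly (node_poly n u) (x\<^sup>2) * w x)"
    and y: "vanishing_moments 0 1 n (\<lambda>x. poly (node_poly n v) (x\<^sup>2) * (x powr (2 * d) * w x))"
  defines "H \<equiv> pencil d (node_poly n u) (node_poly n v) c"
  assumes fin: "finite {t. 0 < t \<and> H t = 0}"
  shows "\<exists>Y\<subseteq>{t. 0 < t \<and> t < 1 \<and> H t = 0}. n \<le> card Y \<and>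
    (\<exists>s\<in>{1, -1}. \<forall>t\<in>{0<..<1}. 0 \<le> s * H t * (\<Prod>z\<in>Y. t - z))"
proof -
  define f where "f = (\<lambda>x. H (x\<^sup>2))"
  have pw: "(x\<^sup>2) powr d = x powr (2 * d)" if "0 < x" for x :: real
    using that by (simp add: powr_powr flip: powr_numeral)
  have wi: "ioo_integrable 0 1 w" and wpos: "\<forall>x\<in>{0<..<1}. 0 < w x"
    using w by (auto simp: weight_on_def)
  have contH: "continuous_on {0..} H" unfolding H_def by (rule pencil_continuous[OF d])
  have contf: "continuous_on {0..1} f"
    unfolding f_def by (intro continuous_on_compose2[OF contH] continuous_intros) auto
  have int1: "ioo_integrable 0 1 (\<lambda>x. c * (poly (node_poly n u) (x\<^sup>2) * w x))"
    by (intro set_integrable_mult_right set_integrable_continuous_mult wi continuous_intros)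
  have "ioo_integrable 0 1 (\<lambda>x. (poly (node_poly n v) (x\<^sup>2) * x powr (2 * d)) * w x)"
    using d by (intro set_integrable_continuous_mult wi continuous_intros continuous_on_powr') auto
  then have int2: "ioo_integrable 0 1 (\<lambda>x. poly (node_poly n v) (x\<^sup>2) * (x powr (2 * d) * w x))"
    by (simp add: mult.assoc)
  have "vanishing_moments 0 1 n (\<lambda>x. poly (node_poly n v) (x\<^sup>2) * (x powr (2 * d) * w x)
      - c * (poly (node_poly n u) (x\<^sup>2) * w x))"
    by (rule vanishing_moments_diff[OF int2 int1 y vanishing_moments_scale[OF x]])
  then have vm: "vanishing_moments 0 1 n (\<lambda>x. f x * w x)"
    by (subst (asm) vanishing_moments_cong[where g = "\<lambda>x. f x * w x"])
       (auto simp: f_def H_def pencil_def pw algebra_simps)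
  have inj: "inj_on (\<lambda>x::real. x\<^sup>2) {0<..}"
    by (rule inj_onI) (simp add: power2_eq_iff_nonneg)
  have "(\<lambda>x. x\<^sup>2) ` {x \<in> {0<..<1}. f x = 0} \<subseteq> {t. 0 < t \<and> H t = 0}"
    by (auto simp: f_def)
  then have "finite ((\<lambda>x. x\<^sup>2) ` {x \<in> {0<..<1}. f x = 0})"
    using fin by (rule finite_subset)
  then have finf: "finite {x \<in> {0<..<1}. f x = 0}"
    by (rule finite_imageD) (rule inj_on_subset[OF inj], auto)
  have fw: "ioo_integrable 0 1 (\<lambda>x. f x * w x)"
    by (rule set_integrable_continuous_mult[OF wi contf])
  have cont': "continuous_on {0<..<1} f" by (rule continuous_on_subset[OF contf]) auto
  from vanishing_moments_sign_changes[OF zero_less_one cont' finf wpos fw vm]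
  obtain X s where X: "X \<subseteq> {x \<in> {0<..<1}. f x = 0}" "n \<le> card X" "s \<in> {1, -1}"
      "\<forall>x\<in>{0<..<1}. 0 \<le> s * f x * (\<Prod>z\<in>X. x - z)"
    by (elim exE conjE bexE)
  define Y where "Y = (\<lambda>x. x\<^sup>2) ` X"
  have injX: "inj_on (\<lambda>x. x\<^sup>2) X"
    by (rule inj_on_subset[OF inj]) (use X(1) in auto)
  have "Y \<subseteq> {t. 0 < t \<and> t < 1 \<and> H t = 0}"
    using X(1) by (auto simp: Y_def f_def power_less_one_iff)
  moreover have "n \<le> card Y" using X(2) injX by (simp add: Y_def card_image)
  moreover have "\<forall>t\<in>{0<..<1}. 0 \<le> s * H t * (\<Prod>z\<in>Y. t - z)"
  proof
    fix t :: real assume t: "t \<in> {0<..<1}"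
    define x where "x = sqrt t"
    have x: "x \<in> {0<..<1}" "x\<^sup>2 = t" using t by (auto simp: x_def)
    have "(\<Prod>z\<in>Y. t - z) = (\<Prod>z\<in>X. (x - z) * (x + z))"
      unfolding Y_def using injX
      by (subst prod.reindex) (auto simp: x(2)[symmetric] power2_eq_square algebra_simps)
    then have "s * H t * (\<Prod>z\<in>Y. t - z) = (s * f x * (\<Prod>z\<in>X. x - z)) * (\<Prod>z\<in>X. x + z)"
      by (simp add: prod.distrib f_def x(2))
    also have "\<dots> \<ge> 0"
    proof (rule mult_nonneg_nonneg)
      show "0 \<le> s * f x * (\<Prod>z\<in>X. x - z)" using X(4) x(1) by blast
      show "0 \<le> (\<Prod>z\<in>X. x + z)" using X(1) x(1) by (intro prod_nonneg) auto
    qed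
    finally show "0 \<le> s * H t * (\<Prod>z\<in>Y. t - z)" .
  qed
  ultimately show ?thesis using X(3) by (intro exI[of _ Y] conjI bexI[of _ s])
qed

text \<open>
  The Wronskian is positive at \<open>0\<close> and has no positive zeros, so it is positive at the zeros \<open>u i\<close> of
  \<open>p\<close>, where it equals \<open>- u i * q (u i) * p' (u i)\<close>. Thus \<open>q\<close> has at \<open>u i\<close> the sign opposite to
  that of \<open>p'\<close>.
\<close>

theorem symmetric_zeros_less:
  fixes x y :: "nat \<Rightarrow> real"
  assumes d: "0 < d" "d < 1" and w: "weight_on 0 1 w"
    and x: "strict_mono_on {..<n} x" "\<And>i. i < n \<Longrightarrow> 0 < x i \<and> x i < 1"
      "vanishing_moments 0 1 n (\<lambda>t. (\<Prod>i<n. t\<^sup>2 - (x i)\<^sup>2) * w t)"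
    and y: "strict_mono_on {..<n} y" "\<And>i. i < n \<Longrightarrow> 0 < y i \<and> y i < 1"
      "vanishing_moments 0 1 n (\<lambda>t. (\<Prod>i<n. t\<^sup>2 - (y i)\<^sup>2) * (t powr (2 * d) * w t))"
    and k: "k < n"
  shows "x k < y k"
proof -
  define u where "u = (\<lambda>i. (x i)\<^sup>2)"
  define v where "v = (\<lambda>i. (y i)\<^sup>2)"
  have n: "0 < n" using k by simp
  have u01: "0 < u i \<and> u i < 1" if "i < n" for i
    using x(2)[OF that] by (simp add: u_def power_less_one_iff)
  have v01: "0 < v i \<and> v i < 1" if "i < n" for i
    using y(2)[OF that] by (simp add: v_def power_less_one_iff)
  have su: "strict_mono_on {..<n} u"
  proof (rule strict_mono_onI)
    fix i j assume "i \<in> {..<n}" "j \<in> {..<n}" "i < j"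
    then show "u i < u j"
      using strict_mono_onD[OF x(1), of i j] x(2)[of i] by (simp add: u_def power_strict_mono)
  qed
  have sv: "strict_mono_on {..<n} v"
  proof (rule strict_mono_onI)
    fix i j assume "i \<in> {..<n}" "j \<in> {..<n}" "i < j"
    then show "v i < v j"
      using strict_mono_onD[OF y(1), of i j] y(2)[of i] by (simp add: v_def power_strict_mono)
  qed
  define p where "p = node_poly n u"
  define q where "q = node_poly n v"
  have px: "vanishing_moments 0 1 n (\<lambda>t. poly (node_poly n u) (t\<^sup>2) * w t)"
    using x(3) by (simp add: u_def)
  have qy: "vanishing_moments 0 1 n (\<lambda>t. poly (node_poly n v) (t\<^sup>2) * (t powr (2 * d) * w t))"
    using y(3) by (simp add: v_def)
  have up: "\<And>i. i < n \<Longrightarrow> 0 < u i" and vp: "\<And>i. i < n \<Longrightarrow> 0 < v i" using u01 v01 by auto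
  have no_double: False
    if c: "c \<noteq> 0" and t: "0 < t" "pencil d p q c t = 0" "(pencil d p q c has_real_derivative 0) (at t)" for c t
  proof -
    have fin: "finite {t. 0 < t \<and> pencil d (node_poly n u) (node_poly n v) c t = 0}"
      by (rule pencil_zeros(1)[OF d up vp c])
    from symmetric_moments_pencil[OF d(1) w px qy fin]
    obtain Y s where Y: "Y \<subseteq> {t. 0 < t \<and> t < 1 \<and> pencil d (node_poly n u) (node_poly n v) c t = 0}"
      "n \<le> card Y" "s \<in> {1, -1}"
      "\<forall>t\<in>{0<..<1}. 0 \<le> s * pencil d (node_poly n u) (node_poly n v) c t * (\<Prod>z\<in>Y. t - z)"
      by (elim exE conjE bexE)
    show False
      by (rule pencil_no_double_zero[OF d n u01 v01 c Y t[unfolded p_def q_def]])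
  qed
  have V_nonzero: "poly (pencil_wronskian d p q) t \<noteq> 0" if "0 < t" for t
  proof
    assume V: "poly (pencil_wronskian d p q) t = 0"
    have simple: "poly p t = 0 \<Longrightarrow> poly (pderiv p) t \<noteq> 0" "poly q t = 0 \<Longrightarrow> poly (pderiv q) t \<noteq> 0"
      unfolding p_def q_def
      using node_poly_simple_roots strict_mono_on_imp_inj_on su sv by blast+
    from pencil_double_zero[OF that V simple] no_double[OF _ that] show False by blast
  qed
  have zero: "poly (node_poly n z) 0 = (-1) ^ n * (\<Prod>i<n. z i)" for z :: "nat \<Rightarrow> real"
    using prod.distrib[of "\<lambda>_. -1" z "{..<n}"] by simp
  have "poly p 0 * poly q 0 = (\<Prod>i<n. u i) * (\<Prod>i<n. v i)"
    unfolding p_def q_def zero by (simp flip: power_mult_distrib)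
  also have "\<dots> > 0" using up vp by (intro mult_pos_pos prod_pos) auto
  finally have V0: "0 < poly (pencil_wronskian d p q) 0"
    unfolding poly_pencil_wronskian using d by simp
  have V_pos: "0 < poly (pencil_wronskian d p q) t" if "0 < t" for t
  proof (rule ccontr)
    assume "\<not> ?thesis"
    then have "poly (pencil_wronskian d p q) t < 0" using V_nonzero[OF that] by simp
    from poly_IVT_neg[OF that V0 this] V_nonzero show False by blast
  qed
  have "0 < (-1) ^ (n - i) * poly (node_poly n v) (u i)" if i: "i < n" for i
  proof -
    have p0: "poly p (u i) = 0" using i by (auto simp: p_def)
    have "0 < poly (pencil_wronskian d p q) (u i)" by (rule V_pos[OF up[OF i]])
    then have "0 < u i * (- (poly q (u i) * poly (pderiv p) (u i)))"
      unfolding poly_pencil_wronskian p0 by simp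
    from zero_less_mult_pos[OF this up[OF i]]
    have neg: "poly q (u i) * poly (pderiv p) (u i) < 0" by simp
    have "0 < (-1) ^ (n - Suc i) * poly (pderiv p) (u i)"
      unfolding p_def by (rule sign_pderiv_node_poly[OF su i])
    moreover have "n - i = Suc (n - Suc i)" using i by simp
    ultimately show ?thesis
      using neg unfolding q_def
      by (cases "even (n - Suc i)") (auto simp: mult_less_0_iff)
  qed
  then have "u k < v k" by (rule sign_pattern_imp_less[OF su sv _ k])
  then show ?thesis using x(2)[OF k] y(2)[OF k] by (simp add: u_def v_def power2_less_imp_less)
qed

section \<open>Jacobi-Angelesco polynomials\<close>

text \<open>
  With the absolute value one formula serves on both intervals.
\<close>

definition jacobi_weight :: "real \<Rightarrow> real \<Rightarrow> real \<Rightarrow> real \<Rightarrow> real \<Rightarrow> real" where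
  "jacobi_weight a \<alpha> \<beta> \<gamma> x = (x - a) powr \<alpha> * \<bar>x\<bar> powr \<beta> * (1 - x) powr \<gamma>"

text \<open>
  The affine image of the integrand of the Beta function.
\<close>

lemma beta_weight_integrable:
  assumes cd: "c < d" and "\<alpha> > -1" "\<beta> > -1"
  shows "ioo_integrable c d (\<lambda>x. (x - c) powr \<alpha> * (d - x) powr \<beta>)"
proof -
  define K where "K = (d - c) powr \<alpha> * (d - c) powr \<beta>"
  define f where "f = (\<lambda>t. indicator {0..1} t *\<^sub>R (t powr \<alpha> * (1 - t) powr \<beta>) :: real)"
  have "integrable lborel f"
    using integrable_Beta[of "\<alpha> + 1" "\<beta> + 1"] assms by (simp add: set_integrable_def f_def)
  from lborel_integrable_real_affine[OF this, of "1 / (d - c)" "- c / (d - c)"]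
  have "integrable lborel (\<lambda>x. f (- c / (d - c) + 1 / (d - c) * x))" using cd by simp
  moreover have "- c / (d - c) + 1 / (d - c) * x = (x - c) / (d - c)" for x
    by (simp add: diff_divide_distrib)
  ultimately have "integrable lborel (\<lambda>x. K * f ((x - c) / (d - c)))" by simp
  moreover have "K * f ((x - c) / (d - c)) = indicator {c..d} x *\<^sub>R ((x - c) powr \<alpha> * (d - x) powr \<beta>)" for x
  proof -
    have "(x - c) / (d - c) \<in> {0..1} \<longleftrightarrow> x \<in> {c..d}" using cd by (auto simp: field_simps)
    moreover have "1 - (x - c) / (d - c) = (d - x) / (d - c)" using cd by (simp add: field_simps)
    moreover have "((x - c) / (d - c)) powr \<alpha> = (x - c) powr \<alpha> / (d - c) powr \<alpha>"
      "((d - x) / (d - c)) powr \<beta> = (d - x) powr \<beta> / (d - c) powr \<beta>" if "x \<in> {c..d}"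
      using cd that by (auto intro!: powr_divide)
    ultimately show ?thesis using cd by (auto simp: f_def K_def indicator_def)
  qed
  ultimately have "set_integrable lborel {c..d} (\<lambda>x. (x - c) powr \<alpha> * (d - x) powr \<beta>)"
    by (simp add: set_integrable_def)
  then show ?thesis by (rule set_integrable_subset) auto
qed

lemma weight_on_jacobi:
  assumes a: "a < 0" and "\<alpha> > -1" "\<beta> > -1" "\<gamma> > -1"
  shows "weight_on a 0 (jacobi_weight a \<alpha> \<beta> \<gamma>)" and "weight_on 0 1 (jacobi_weight a \<alpha> \<beta> \<gamma>)"
proof -
  have "ioo_integrable a 0 (\<lambda>x. (1 - x) powr \<gamma> * ((x - a) powr \<alpha> * (0 - x) powr \<beta>))"
    using assms by (intro set_integrable_continuous_mult beta_weight_integrable continuous_intros) auto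
  then have "ioo_integrable a 0 (jacobi_weight a \<alpha> \<beta> \<gamma>)"
    by (rule set_integrable_cong[THEN iffD1, rotated -1]) (auto simp: jacobi_weight_def)
  then show "weight_on a 0 (jacobi_weight a \<alpha> \<beta> \<gamma>)"
    using a by (auto simp: weight_on_def jacobi_weight_def)
  have "ioo_integrable 0 1 (\<lambda>x. (x - a) powr \<alpha> * ((x - 0) powr \<beta> * (1 - x) powr \<gamma>))"
    using assms by (intro set_integrable_continuous_mult beta_weight_integrable continuous_intros) auto
  then have "ioo_integrable 0 1 (jacobi_weight a \<alpha> \<beta> \<gamma>)"
    by (rule set_integrable_cong[THEN iffD1, rotated -1]) (auto simp: jacobi_weight_def)
  then show "weight_on 0 1 (jacobi_weight a \<alpha> \<beta> \<gamma>)"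
    using a by (auto simp: weight_on_def jacobi_weight_def)
qed

lemma is_jacobi_angelesco_iff:
  "is_jacobi_angelesco n a \<alpha> \<beta> \<gamma> p \<longleftrightarrow> lead_coeff p = 1 \<and> degree p = 2 * n \<and>
     vanishing_moments a 0 n (\<lambda>x. poly p x * jacobi_weight a \<alpha> \<beta> \<gamma> x) \<and>
     vanishing_moments 0 1 n (\<lambda>x. poly p x * jacobi_weight a \<alpha> \<beta> \<gamma> x)"
proof -
  have "ioo_integral 0 1 (\<lambda>x. x ^ k * poly p x * (x - a) powr \<alpha> * x powr \<beta> * (1 - x) powr \<gamma>)
      = ioo_integral 0 1 (\<lambda>x. x ^ k * (poly p x * jacobi_weight a \<alpha> \<beta> \<gamma> x))" for k
    by (rule set_lebesgue_integral_cong) (auto simp: jacobi_weight_def mult_ac)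
  then show ?thesis
    by (simp add: is_jacobi_angelesco_def vanishing_moments_def jacobi_weight_def mult_ac)
qed

text \<open>
  The description of the polynomial by a fixed point and the one by moments agree, since a fixed point
  yields a solution of the moment problem and solutions are unique.
\<close>

lemma jacobi_angelesco_nodes:
  assumes params: "a < 0" "\<alpha> > -1" "\<beta> > -1" "\<gamma> > -1"
  shows "\<exists>z. angelesco_image a 0 1 (jacobi_weight a \<alpha> \<beta> \<gamma>) n z z \<and>
    (\<forall>j<2 * n. jacobi_angelesco_zero n (Suc j) a \<alpha> \<beta> \<gamma> = z j)"
proof -
  let ?w = "jacobi_weight a \<alpha> \<beta> \<gamma>"
  note w = weight_on_jacobi[OF params]
  obtain z where z: "angelesco_image a 0 1 ?w n z z" using angelesco_nodes_exist[OF w] by blast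
  note P = angelesco_nodes_poly[OF z]
  have "jacobi_angelesco n a \<alpha> \<beta> \<gamma> = node_poly (2 * n) z"
    unfolding jacobi_angelesco_def
  proof (rule the_equality)
    show "is_jacobi_angelesco n a \<alpha> \<beta> \<gamma> (node_poly (2 * n) z)"
      using P(2,3) by (simp add: is_jacobi_angelesco_iff del: poly_node_poly)
    fix p assume "is_jacobi_angelesco n a \<alpha> \<beta> \<gamma> p"
    then show "p = node_poly (2 * n) z"
      unfolding is_jacobi_angelesco_iff
      by (intro angelesco_poly_unique[OF w _ _ _ _ _ _ P(2,3)]) (auto simp del: poly_node_poly)
  qed
  then have "jacobi_angelesco_zero n (Suc j) a \<alpha> \<beta> \<gamma> = z j" if "j < 2 * n" for j
    using sorted_roots_node_poly[OF P(1)] that by (simp add: jacobi_angelesco_zero_def del: poly_node_poly)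
  with z show ?thesis by blast
qed

lemma jacobi_angelesco_zeros_less:
  fixes r :: "real \<Rightarrow> real"
  assumes a: "a < 0" and v: "\<alpha> > -1" "\<beta> > -1" "\<gamma> > -1" and w: "\<alpha>' > -1" "\<beta>' > -1" "\<gamma>' > -1"
    and ratio: "\<forall>t\<in>{a<..<1}. jacobi_weight a \<alpha>' \<beta>' \<gamma>' t = r t * jacobi_weight a \<alpha> \<beta> \<gamma> t"
    and r: "strict_mono_on {a<..<1} r" and j: "j \<in> {1..2 * n}"
  shows "jacobi_angelesco_zero n j a \<alpha> \<beta> \<gamma> < jacobi_angelesco_zero n j a \<alpha>' \<beta>' \<gamma>'"
proof -
  obtain x where x: "angelesco_image a 0 1 (jacobi_weight a \<alpha> \<beta> \<gamma>) n x x"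
    "\<forall>j<2 * n. jacobi_angelesco_zero n (Suc j) a \<alpha> \<beta> \<gamma> = x j"
    using jacobi_angelesco_nodes[OF a v] by blast
  obtain y where y: "angelesco_image a 0 1 (jacobi_weight a \<alpha>' \<beta>' \<gamma>') n y y"
    "\<forall>j<2 * n. jacobi_angelesco_zero n (Suc j) a \<alpha>' \<beta>' \<gamma>' = y j"
    using jacobi_angelesco_nodes[OF a w] by blast
  have l: "\<forall>t\<in>{a<..<0}. jacobi_weight a \<alpha>' \<beta>' \<gamma>' t = r t * jacobi_weight a \<alpha> \<beta> \<gamma> t"
    "strict_mono_on {a<..<0} r"
    using ratio r a by (auto simp: strict_mono_on_def)
  have rr: "\<forall>t\<in>{0<..<1}. jacobi_weight a \<alpha>' \<beta>' \<gamma>' t = r t * jacobi_weight a \<alpha> \<beta> \<gamma> t"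
    "strict_mono_on {0<..<1} r"
    using ratio r a by (auto simp: strict_mono_on_def)
  have "\<forall>i<2 * n. x i < y i"
    by (rule angelesco_zeros_strict_mono[OF weight_on_jacobi[OF a v] weight_on_jacobi[OF a w] l rr x(1) y(1)])
  moreover obtain i where "j = Suc i" "i < 2 * n" using j by (cases j) auto
  ultimately show ?thesis using x(2) y(2) by simp
qed

lemma jacobi_angelesco_zeros_increase_alpha:
  assumes "a < 0" "\<alpha> > -1" "\<alpha> < \<alpha>'" "\<beta> > -1" "\<gamma> > -1" "j \<in> {1..2 * n}"
  shows "jacobi_angelesco_zero n j a \<alpha> \<beta> \<gamma> < jacobi_angelesco_zero n j a \<alpha>' \<beta> \<gamma>"
proof (rule jacobi_angelesco_zeros_less[where r = "\<lambda>t. (t - a) powr (\<alpha>' - \<alpha>)"])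
  show "\<forall>t\<in>{a<..<1}. jacobi_weight a \<alpha>' \<beta> \<gamma> t = (t - a) powr (\<alpha>' - \<alpha>) * jacobi_weight a \<alpha> \<beta> \<gamma> t"
    by (auto simp: jacobi_weight_def simp flip: powr_add)
  show "strict_mono_on {a<..<1} (\<lambda>t. (t - a) powr (\<alpha>' - \<alpha>))"
    using assms by (auto simp: strict_mono_on_def intro!: powr_less_mono2)
qed (use assms in auto)

lemma jacobi_angelesco_zeros_decrease_gamma:
  assumes "a < 0" "\<gamma> > -1" "\<gamma> < \<gamma>'" "\<alpha> > -1" "\<beta> > -1" "j \<in> {1..2 * n}"
  shows "jacobi_angelesco_zero n j a \<alpha> \<beta> \<gamma>' < jacobi_angelesco_zero n j a \<alpha> \<beta> \<gamma>"
proof (rule jacobi_angelesco_zeros_less[where r = "\<lambda>t. (1 - t) powr (\<gamma> - \<gamma>')"])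
  show "\<forall>t\<in>{a<..<1}. jacobi_weight a \<alpha> \<beta> \<gamma> t = (1 - t) powr (\<gamma> - \<gamma>') * jacobi_weight a \<alpha> \<beta> \<gamma>' t"
    by (auto simp: jacobi_weight_def simp flip: powr_add)
  show "strict_mono_on {a<..<1} (\<lambda>t. (1 - t) powr (\<gamma> - \<gamma>'))"
    using assms by (auto simp: strict_mono_on_def intro!: powr_less_mono2_neg)
qed (use assms in auto)

lemma vanishing_moments_reflect:
  assumes "vanishing_moments c d n g"
  shows "vanishing_moments (- d) (- c) n (\<lambda>x. g (- x))"
  unfolding vanishing_moments_def
proof (intro allI impI)
  fix k assume k: "k < n"
  have set: "{x. - x \<in> {- d<..<- c}} = {c<..<d}" by auto
  have "ioo_integral (- d) (- c) (\<lambda>x. x ^ k * g (- x))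
      = set_lebesgue_integral lborel {x. - x \<in> {- d<..<- c}} (\<lambda>x. (- x) ^ k * g (- (- x)))"
    by (rule set_integral_reflect)
  also have "\<dots> = ioo_integral c d (\<lambda>x. (- x) ^ k * g x)"
    unfolding set minus_minus ..
  also have "\<dots> = ioo_integral c d (\<lambda>x. (-1) ^ k * (x ^ k * g x))"
    by (subst power_minus) (simp only: mult.assoc)
  also have "\<dots> = 0" using assms k by (simp add: vanishing_moments_def)
  finally show "ioo_integral (- d) (- c) (\<lambda>x. x ^ k * g (- x)) = 0" .
qed

text \<open>
  The reflected polynomial solves the same moment problem, so the polynomial is even.
\<close>

lemma symmetric_nodes:
  assumes w: "weight_on (-1) 0 w" "weight_on 0 1 w" and even: "\<And>x. w (- x) = w x"
    and z: "angelesco_image (-1) 0 1 w n z z" and i: "i < n"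
  shows "z i = - z (n + (n - Suc i))"
proof -
  note P = angelesco_nodes_poly[OF z]
  define p where "p = node_poly (2 * n) z"
  define q where "q = pcompose p [:0, -1:]"
  have pq: "poly q x = poly p (- x)" for x by (simp add: q_def poly_pcompose)
  have degq: "degree q = 2 * n" by (simp add: q_def p_def degree_pcompose)
  have lcq: "lead_coeff q = 1"
    unfolding q_def by (subst lead_coeff_comp) (simp_all add: p_def)
  have "vanishing_moments (-1) 0 n (\<lambda>x. poly q x * w x)" "vanishing_moments 0 1 n (\<lambda>x. poly q x * w x)"
    using vanishing_moments_reflect[OF P(3)] vanishing_moments_reflect[OF P(2)]
    by (simp_all add: pq p_def even)
  then have "q = p"
    unfolding p_def
    by (intro angelesco_poly_unique[OF w lcq degq _ _ _ _ P(2,3)]) (simp_all del: poly_node_poly)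
  then have sym: "poly p (- x) = poly p x" for x using pq by simp
  \<comment> \<open>the reflected zeros, in increasing order\<close>
  define z' where "z' = (\<lambda>i. - z (2 * n - Suc i))"
  have z': "strict_mono_on {..<2 * n} z'"
    unfolding z'_def by (rule strict_mono_onI) (auto intro!: strict_mono_onD[OF P(1)])
  have "poly p (z' i) = 0" if "i < 2 * n" for i
  proof -
    have "poly p (z (2 * n - Suc i)) = 0"
      unfolding p_def poly_node_poly by (rule prod_zero) (use that in \<open>auto intro!: bexI[of _ "2 * n - Suc i"]\<close>)
    then show ?thesis by (simp add: z'_def sym)
  qed
  then have "p = node_poly (2 * n) z'"
    using strict_mono_on_imp_inj_on[OF z'] by (intro monic_eq_node_poly) (simp_all add: p_def)
  then have "map z [0..<2 * n] = map z' [0..<2 * n]"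
    using sorted_roots_node_poly[OF P(1)] sorted_roots_node_poly[OF z'] by (simp add: p_def)
  then have "z i = z' i" using i by (auto simp: map_eq_conv)
  moreover have "2 * n - Suc i = n + (n - Suc i)" using i by simp
  ultimately show ?thesis by (simp only: z'_def)
qed

lemma symmetric_nodes_moments:
  assumes w: "weight_on (-1) 0 w" "weight_on 0 1 w" and even: "\<And>x. w (- x) = w x"
    and z: "angelesco_image (-1) 0 1 w n z z"
  shows "vanishing_moments 0 1 n (\<lambda>t. (\<Prod>i<n. t\<^sup>2 - (z (n + i))\<^sup>2) * w t)"
proof -
  have "(\<Prod>i<n. t\<^sup>2 - (z (n + i))\<^sup>2) = poly (node_poly (2 * n) z) t" for t
  proof -
    have "(\<Prod>i<n. t - z i) = (\<Prod>i<n. t + z (n + (n - Suc i)))"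
      using symmetric_nodes[OF w even z] by (intro prod.cong) auto
    also have "\<dots> = (\<Prod>i<n. t + z (n + i))"
      by (rule prod.nat_diff_reindex)
    finally show ?thesis
      using prod_lessThan_add[of "\<lambda>i. t - z i" n n]
      by (simp add: mult_2 power2_eq_square square_diff_square_factored prod.distrib)
  qed
  then show ?thesis using angelesco_nodes_poly(3)[OF z] by simp
qed

lemma jacobi_weight_even: "jacobi_weight (-1) \<alpha> \<beta> \<alpha> (- x) = jacobi_weight (-1) \<alpha> \<beta> \<alpha> x"
  by (simp add: jacobi_weight_def add.commute mult_ac)

lemma jacobi_angelesco_zero_symmetric:
  assumes "\<alpha> > -1" "\<beta> > -1" "j \<in> {1..n}"
  shows "jacobi_angelesco_zero n j (-1) \<alpha> \<beta> \<alpha> = - jacobi_angelesco_zero n (2 * n + 1 - j) (-1) \<alpha> \<beta> \<alpha>"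
proof -
  have a: "(-1::real) < 0" by simp
  obtain z where z: "angelesco_image (-1) 0 1 (jacobi_weight (-1) \<alpha> \<beta> \<alpha>) n z z"
    "\<forall>j<2 * n. jacobi_angelesco_zero n (Suc j) (-1) \<alpha> \<beta> \<alpha> = z j"
    using jacobi_angelesco_nodes[OF a assms(1,2,1)] by blast
  obtain i where i: "j = Suc i" "i < n" using assms(3) by (cases j) auto
  have "2 * n + 1 - j = Suc (n + (n - Suc i))" using i by simp
  then show ?thesis
    using symmetric_nodes[OF weight_on_jacobi[OF a assms(1,2,1)] jacobi_weight_even z(1) i(2)] z(2) i by simp
qed

text \<open>
  The restriction to steps shorter than 2 keeps \<open>d = (\<beta>' - \<beta>) / 2\<close> below 1, as the sign
  rule for the pencil demands.
\<close>

lemma jacobi_angelesco_positive_zeros_increase_beta: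
  assumes \<alpha>: "\<alpha> > -1" and \<beta>: "\<beta> > -1" "\<beta> < \<beta>'" "\<beta>' < \<beta> + 2" and j: "j \<in> {n + 1..2 * n}"
  shows "jacobi_angelesco_zero n j (-1) \<alpha> \<beta> \<alpha> < jacobi_angelesco_zero n j (-1) \<alpha> \<beta>' \<alpha>"
proof -
  have a: "(-1::real) < 0" by simp
  have \<beta>': "\<beta>' > -1" using \<beta> by simp
  define w where "w = jacobi_weight (-1) \<alpha> \<beta> \<alpha>"
  define w' where "w' = jacobi_weight (-1) \<alpha> \<beta>' \<alpha>"
  note wj = weight_on_jacobi[OF a \<alpha> \<beta>(1) \<alpha>, folded w_def]
  note wj' = weight_on_jacobi[OF a \<alpha> \<beta>' \<alpha>, folded w'_def]
  obtain x where x: "angelesco_image (-1) 0 1 w n x x"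
    "\<forall>j<2 * n. jacobi_angelesco_zero n (Suc j) (-1) \<alpha> \<beta> \<alpha> = x j"
    unfolding w_def using jacobi_angelesco_nodes[OF a \<alpha> \<beta>(1) \<alpha>] by blast
  obtain y where y: "angelesco_image (-1) 0 1 w' n y y"
    "\<forall>j<2 * n. jacobi_angelesco_zero n (Suc j) (-1) \<alpha> \<beta>' \<alpha> = y j"
    unfolding w'_def using jacobi_angelesco_nodes[OF a \<alpha> \<beta>' \<alpha>] by blast
  define d where "d = (\<beta>' - \<beta>) / 2"
  have d: "0 < d" "d < 1" using \<beta> by (auto simp: d_def)
  have xr: "strict_mono_on {..<n} (\<lambda>i. x (n + i))" "\<And>i. i < n \<Longrightarrow> 0 < x (n + i) \<and> x (n + i) < 1"
    using x(1) by (auto simp: angelesco_image_def orth_nodes_def)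
  have yr: "strict_mono_on {..<n} (\<lambda>i. y (n + i))" "\<And>i. i < n \<Longrightarrow> 0 < y (n + i) \<and> y (n + i) < 1"
    using y(1) by (auto simp: angelesco_image_def orth_nodes_def)
  have mx: "vanishing_moments 0 1 n (\<lambda>t. (\<Prod>i<n. t\<^sup>2 - (x (n + i))\<^sup>2) * w t)"
    by (rule symmetric_nodes_moments[OF wj _ x(1)]) (simp add: w_def jacobi_weight_even)
  have "vanishing_moments 0 1 n (\<lambda>t. (\<Prod>i<n. t\<^sup>2 - (y (n + i))\<^sup>2) * w' t)"
    by (rule symmetric_nodes_moments[OF wj' _ y(1)]) (simp add: w'_def jacobi_weight_even)
  moreover have "w' t = t powr (2 * d) * w t" if "t \<in> {0<..<1}" for t
  proof -
    have "2 * d + \<beta> = \<beta>'" by (simp add: d_def field_simps)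
    then have "t powr \<beta>' = t powr (2 * d) * t powr \<beta>" by (metis powr_add)
    then show ?thesis using that by (simp add: w_def w'_def jacobi_weight_def)
  qed
  ultimately have my: "vanishing_moments 0 1 n (\<lambda>t. (\<Prod>i<n. t\<^sup>2 - (y (n + i))\<^sup>2) * (t powr (2 * d) * w t))"
    by (subst (asm) vanishing_moments_cong[where g = "\<lambda>t. (\<Prod>i<n. t\<^sup>2 - (y (n + i))\<^sup>2) * (t powr (2 * d) * w t)"]) auto
  have "j = Suc (n + (j - Suc n))" "j - Suc n < n" using j by auto
  moreover have "x (n + (j - Suc n)) < y (n + (j - Suc n))"
    using j by (intro symmetric_zeros_less[OF d wj(2) xr mx yr my]) auto
  ultimately show ?thesis using x(2)[rule_format, of "n + (j - Suc n)"] y(2)[rule_format, of "n + (j - Suc n)"] by simp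
qed

text \<open>
  Induction on the number of steps of length \<open>h / 2\<close> needed to get from \<open>x\<close> to \<open>y\<close>.
\<close>

lemma strict_mono_on_from_local:
  fixes f :: "real \<Rightarrow> real"
  assumes "0 < h" and loc: "\<And>x y. b < x \<Longrightarrow> x < y \<Longrightarrow> y < x + h \<Longrightarrow> f x < f y"
  shows "strict_mono_on {b<..} f"
proof (rule strict_mono_onI)
  fix x y :: real assume "x \<in> {b<..}" "x < y"
  have step: "\<forall>x y. b < x \<longrightarrow> x < y \<longrightarrow> y < x + real m * (h / 2) \<longrightarrow> f x < f y" for m
  proof (induction m)
    case (Suc m)
    show ?case
    proof (intro allI impI)
      fix x y assume xy: "b < x" "x < y" "y < x + real (Suc m) * (h / 2)"
      show "f x < f y"
      proof (cases "y < x + h")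
        case False
        have "f x < f (x + h / 2)" using xy \<open>0 < h\<close> by (intro loc) auto
        also have "\<dots> < f y" using xy False \<open>0 < h\<close>
          by (intro Suc[rule_format]) (auto simp: algebra_simps add_divide_distrib)
        finally show ?thesis .
      qed (use xy loc in auto)
    qed
  qed simp
  obtain m where "y - x < real m * (h / 2)"
    using reals_Archimedean3[of "h / 2"] \<open>0 < h\<close> by (metis half_gt_zero)
  then have "y < x + real m * (h / 2)" by linarith
  then show "f x < f y" using step[of m] \<open>x \<in> {b<..}\<close> \<open>x < y\<close> by simp
qed

theorem theorem3p1:
  fixes n :: nat
  assumes "n \<ge> 1"
  shows
    "(\<forall>a \<beta> \<gamma>. a < 0 \<and> \<beta> > -1 \<and> \<gamma> > -1 \<longrightarrow>
        (\<forall>j\<in>{1..2*n}. strict_mono_on {-1<..} (\<lambda>\<alpha>. jacobi_angelesco_zero n j a \<alpha> \<beta> \<gamma>))) \<and>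
     (\<forall>\<alpha>. \<alpha> > -1 \<longrightarrow>
        (\<forall>j\<in>{1..n}. strict_antimono_on {-1<..} (\<lambda>\<beta>. jacobi_angelesco_zero n j (-1) \<alpha> \<beta> \<alpha>)) \<and>
        (\<forall>j\<in>{n+1..2*n}. strict_mono_on {-1<..} (\<lambda>\<beta>. jacobi_angelesco_zero n j (-1) \<alpha> \<beta> \<alpha>))) \<and>
     (\<forall>a \<alpha> \<beta>. a < 0 \<and> \<alpha> > -1 \<and> \<beta> > -1 \<longrightarrow>
        (\<forall>j\<in>{1..2*n}. strict_antimono_on {-1<..} (\<lambda>\<gamma>. jacobi_angelesco_zero n j a \<alpha> \<beta> \<gamma>)))"
proof -
  have pos: "strict_mono_on {-1<..} (\<lambda>\<beta>. jacobi_angelesco_zero n j (-1) \<alpha> \<beta> \<alpha>)"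
    if "\<alpha> > -1" "j \<in> {n+1..2*n}" for \<alpha> j
    using that by (intro strict_mono_on_from_local[of 2] jacobi_angelesco_positive_zeros_increase_beta) auto
  have neg: "strict_antimono_on {-1<..} (\<lambda>\<beta>. jacobi_angelesco_zero n j (-1) \<alpha> \<beta> \<alpha>)"
    if \<alpha>: "\<alpha> > -1" and j: "j \<in> {1..n}" for \<alpha> j
  proof (rule monotone_onI)
    fix \<beta> \<beta>' :: real assume \<beta>: "\<beta> \<in> {-1<..}" "\<beta>' \<in> {-1<..}" "\<beta> < \<beta>'"
    have "2 * n + 1 - j \<in> {n+1..2*n}" using j by auto
    from strict_mono_onD[OF pos[OF \<alpha> this] \<beta>]
    show "jacobi_angelesco_zero n j (-1) \<alpha> \<beta> \<alpha> > jacobi_angelesco_zero n j (-1) \<alpha> \<beta>' \<alpha>"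
      using \<beta> by (simp add: jacobi_angelesco_zero_symmetric[OF \<alpha> _ j])
  qed
  show ?thesis
  proof (intro conjI allI impI ballI)
    fix a \<beta> \<gamma> :: real and j assume "a < 0 \<and> \<beta> > -1 \<and> \<gamma> > -1" "j \<in> {1..2*n}"
    then show "strict_mono_on {-1<..} (\<lambda>\<alpha>. jacobi_angelesco_zero n j a \<alpha> \<beta> \<gamma>)"
      by (intro strict_mono_onI jacobi_angelesco_zeros_increase_alpha) auto
  next
    fix \<alpha> :: real and j assume "\<alpha> > -1" "j \<in> {1..n}"
    then show "strict_antimono_on {-1<..} (\<lambda>\<beta>. jacobi_angelesco_zero n j (-1) \<alpha> \<beta> \<alpha>)"
      by (rule neg)
  next
    fix \<alpha> :: real and j assume "\<alpha> > -1" "j \<in> {n+1..2*n}"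
    then show "strict_mono_on {-1<..} (\<lambda>\<beta>. jacobi_angelesco_zero n j (-1) \<alpha> \<beta> \<alpha>)"
      by (rule pos)
  next
    fix a \<alpha> \<beta> :: real and j assume "a < 0 \<and> \<alpha> > -1 \<and> \<beta> > -1" "j \<in> {1..2*n}"
    then show "strict_antimono_on {-1<..} (\<lambda>\<gamma>. jacobi_angelesco_zero n j a \<alpha> \<beta> \<gamma>)"
      by (intro monotone_onI jacobi_angelesco_zeros_decrease_gamma) auto
  qed
qed

end
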